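(* Let $d\ge 1$ and let $\Omega\subset\mathbb{R}^d$ be a bounded open set that satisfies an interior cone condition and has a Lipschitz boundary. Let $\nu$ be a Borel probability measure on $\Omega$ with a bounded density function with respect to the Lebesgue measure. Let $k(x,x')=\Phi(x-x')$, where $\Phi\colon\mathbb{R}^d\to\mathbb{R}$ is a continuous and integrable positive-definite function for which there are constants $r>d/2$ and $c_1,c_2>0$ such that $c_1(1+\|\xi\|^2)^{-r}\le\hat\Phi(\xi)\le c_2(1+\|\xi\|^2)^{-r}$ for all $\xi\in\mathbb{R}^d$. Let $(X_n)_{n\ge2}$ be a sequence of sets $X_n\subset\Omega$ of $n$ distinct points and let $\Lambda_{X_n}^{\mathrm{BQ}}=\sum_{i=1}^n|w_{X_n,i}^{\mathrm{BQ}}|$. Then there are constants $C>0$ and $h_0>0$, independent of $n$, such that $$\Lambda_{X_n}^{\mathrm{BQ}}\le C\,n\left(\frac{h_{X_n,\Omega}}{q_{X_n}}\right)^{r-d/2}h_{X_n,\Omega}^{d/2}$$ whenever $h_{X_n,\Omega}\le h_0$. Moreover, if the sets $X_n$ are quasi-uniform, then there are $C'>0$ and $n_0\in\mathbb{N}$ such that $\Lambda_{X_n}^{\mathrm{BQ}}\le C'\sqrt{n}$ for all $n\ge n_0$.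
   Context: Bayesian quadrature weights: for $X_n=\{x_1,\ldots,x_n\}\subset\Omega$ distinct, $w_{X_n}^{\mathrm{BQ}}=(w_{X_n,i}^{\mathrm{BQ}})_{i=1}^n=K_{X_n}^{-1}k_{\nu,X_n}$, where $[K_{X_n}]_{ij}=k(x_j,x_i)$ (an invertible matrix) and $[k_{\nu,X_n}]_i=k_\nu(x_i)$ with $k_\nu(x)=\int_\Omega k(y,x)\,\mathrm{d}\nu(y)$. Fourier transform: $\hat f(\xi)=(2\pi)^{-d/2}\int_{\mathbb{R}^d}f(x)e^{-\sqrt{-1}\,\xi^{\mathsf T}x}\,\mathrm{d}x$. Fill-distance: $h_{X_n,\Omega}=\sup_{x\in\Omega}\min_{i=1,\ldots,n}\|x-x_i\|$. Separation distance: $q_{X_n}=\frac12\min_{i\ne j}\|x_i-x_j\|$. The sets $X_n$ are quasi-uniform if there are constants $\tilde c_1,\tilde c_2>0$ independent of $n$ with $\tilde c_1 q_{X_n}\le h_{X_n,\Omega}\le\tilde c_2 q_{X_n}$ for all $n$. Interior cone condition: there are an angle $\theta\in(0,\pi/2)$ and a radius $R>0$ such that for each $x\in\Omega$ there is a unit vector $\xi(x)$ such that the cone $\{x+\lambda y : y\in\mathbb{R}^d,\ \|y\|=1,\ y^{\mathsf T}\xi(x)\ge\cos\theta,\ \lambda\in[0,R]\}$ is contained in $\Omega$. Lipschitz boundary has its standard meaning. *)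

theory Defs
  imports
    "HOL-Probability.Probability"
    "HOL-Library.Complex_Order"
    "Jordan_Normal_Form.Gauss_Jordan_Elimination"
begin

definition interior_cone_condition :: "'a::euclidean_space set \<Rightarrow> bool" where
  "interior_cone_condition \<Omega> \<longleftrightarrow>
    (\<exists>\<theta> R. 0 < \<theta> \<and> \<theta> < pi / 2 \<and> 0 < R \<and>
      (\<forall>x\<in>\<Omega>. \<exists>\<xi>. norm \<xi> = 1 \<and>
        {x + l *\<^sub>R y |l y. norm y = 1 \<and> cos \<theta> \<le> y \<bullet> \<xi> \<and> 0 \<le> l \<and> l \<le> R} \<subseteq> \<Omega>))"

text \<open>
  Near each boundary point the set is, after a rigid motion, the strict epigraph of a Lipschitz
  function. The unit vector \<open>e\<close> is the vertical direction, \<open>x \<bullet> e\<close> the height of \<open>x\<close> and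
  \<open>x - (x \<bullet> e) *\<^sub>R e\<close> its projection to the hyperplane orthogonal to \<open>e\<close>. No generality is lost
  by having \<open>g\<close> defined on the whole hyperplane, as real-valued Lipschitz functions extend.
\<close>

definition lipschitz_boundary :: "'a::euclidean_space set \<Rightarrow> bool" where
  "lipschitz_boundary \<Omega> \<longleftrightarrow>
    (\<forall>p\<in>frontier \<Omega>. \<exists>e U L. \<exists>g :: 'a \<Rightarrow> real.
      norm e = 1 \<and> open U \<and> p \<in> U \<and> L-lipschitz_on {y. y \<bullet> e = 0} g \<and>
      \<Omega> \<inter> U = {x\<in>U. g (x - (x \<bullet> e) *\<^sub>R e) < x \<bullet> e})"

definition probability_with_bounded_density :: "'a::euclidean_space set \<Rightarrow> 'a measure \<Rightarrow> bool" where
  "probability_with_bounded_density \<Omega> \<nu> \<longleftrightarrow>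
    prob_space \<nu> \<and> sets \<nu> = sets (restrict_space borel \<Omega>) \<and>
    (\<exists>p :: 'a \<Rightarrow> real. p \<in> borel_measurable (restrict_space lborel \<Omega>) \<and>
      (\<forall>x\<in>\<Omega>. 0 \<le> p x) \<and> bounded (p ` \<Omega>) \<and>
      \<nu> = density (restrict_space lborel \<Omega>) (\<lambda>x. ennreal (p x)))"

text \<open>
  For real-valued functions, positive-definiteness with complex coefficients amounts to evenness
  together with positive-definiteness for real coefficients.
\<close>

definition positive_definite_function :: "('a::real_vector \<Rightarrow> real) \<Rightarrow> bool" where
  "positive_definite_function \<Phi> \<longleftrightarrow>
    (\<forall>x. \<Phi> (- x) = \<Phi> x) \<and>
    (\<forall>P c. finite P \<and> (\<exists>p\<in>P. c p \<noteq> 0) \<longrightarrow> 0 < (\<Sum>p\<in>P. \<Sum>q\<in>P. c p * c q * \<Phi> (p - q)))"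

definition fourier_transform :: "('a::euclidean_space \<Rightarrow> real) \<Rightarrow> 'a \<Rightarrow> complex" where
  "fourier_transform f \<xi> =
    complex_of_real ((2 * pi) powr (- real DIM('a) / 2)) *
    (LINT x|lborel. complex_of_real (f x) * exp (- \<i> * complex_of_real (\<xi> \<bullet> x)))"

definition fill_distance :: "'a::real_normed_vector set \<Rightarrow> 'a set \<Rightarrow> real" where
  "fill_distance P \<Omega> = (SUP x\<in>\<Omega>. Min ((\<lambda>p. norm (x - p)) ` P))"

definition separation_distance :: "'a::real_normed_vector set \<Rightarrow> real" where
  "separation_distance P = Min {norm (p - q) |p q. p \<in> P \<and> q \<in> P \<and> p \<noteq> q} / 2"

text \<open>
  A sequence of point sets is given by enumerations: the \<open>n\<close>-th set consists of the points
  \<open>x n i\<close> with \<open>i < n\<close>, and only \<open>n \<ge> 2\<close> is relevant.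
\<close>

definition quasi_uniform :: "(nat \<Rightarrow> nat \<Rightarrow> 'a::real_normed_vector) \<Rightarrow> 'a set \<Rightarrow> bool" where
  "quasi_uniform x \<Omega> \<longleftrightarrow>
    (\<exists>c1 c2. 0 < c1 \<and> 0 < c2 \<and>
      (\<forall>n\<ge>2. c1 * separation_distance (x n ` {..<n}) \<le> fill_distance (x n ` {..<n}) \<Omega> \<and>
        fill_distance (x n ` {..<n}) \<Omega> \<le> c2 * separation_distance (x n ` {..<n})))"

definition kernel_mean :: "('a \<Rightarrow> 'a \<Rightarrow> real) \<Rightarrow> 'a measure \<Rightarrow> 'a \<Rightarrow> real" where
  "kernel_mean k \<nu> x = (LINT y|\<nu>. k y x)"

definition kernel_matrix :: "('a \<Rightarrow> 'a \<Rightarrow> real) \<Rightarrow> nat \<Rightarrow> (nat \<Rightarrow> 'a) \<Rightarrow> real mat" where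
  "kernel_matrix k n x = Matrix.mat n n (\<lambda>(i, j). k (x j) (x i))"

text \<open>
  For a positive-definite kernel and distinct points the kernel matrix is invertible, so that
  \<open>mat_inverse\<close> is \<open>Some\<close> of its inverse.
\<close>

definition bq_weights ::
    "('a \<Rightarrow> 'a \<Rightarrow> real) \<Rightarrow> 'a measure \<Rightarrow> nat \<Rightarrow> (nat \<Rightarrow> 'a) \<Rightarrow> real Matrix.vec" where
  "bq_weights k \<nu> n x =
    the (mat_inverse (kernel_matrix k n x)) *\<^sub>v Matrix.vec n (\<lambda>i. kernel_mean k \<nu> (x i))"

definition bq_lebesgue_constant ::
    "('a \<Rightarrow> 'a \<Rightarrow> real) \<Rightarrow> 'a measure \<Rightarrow> nat \<Rightarrow> (nat \<Rightarrow> 'a) \<Rightarrow> real" where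
  "bq_lebesgue_constant k \<nu> n x = (\<Sum>i<n. \<bar>vec_index (bq_weights k \<nu> n x) i\<bar>)"

end

theory Submission
  imports
    Defs
    "Jordan_Normal_Form.Determinant"
begin

text \<open>
  Write \<open>h\<close> for the fill distance, \<open>q\<close> for the separation distance, \<open>\<alpha> = r - d/2\<close>, and let \<open>w\<close> be the
  weights. With \<open>s\<^sub>i = sgn w\<^sub>i\<close> and \<open>f\<close> the kernel interpolant of the data \<open>s\<close>, symmetry of the kernel
  matrix turns the Lebesgue constant into an integral: \<open>\<Sum>\<bar>w\<^sub>i\<bar> = \<Sum>s\<^sub>i w\<^sub>i = \<integral>f d\<nu>\<close>, so it is at most
  \<open>sup \<bar>f\<bar>\<close> over \<open>\<Omega>\<close>. Two facts about \<open>f\<close> give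
  \<open>\<Sum>\<bar>w\<^sub>i\<bar> \<le> C sqrt n (h/q)\<^sup>\<alpha>\<close> for small \<open>h\<close> (\<open>bq_lebesgue_constant_le\<close>):

  \<^item> Stability (\<open>kernel_matrix_coercive\<close>, \<open>interpolant_energy_le\<close>): the smallest eigenvalue of the
    kernel matrix is at least a constant times \<open>q\<^bsup>2\<alpha>\<^esup>\<close>, whence the squared native norm ("energy") of
    an interpolant of data bounded by 1 is at most a constant times \<open>n q\<^bsup>-2\<alpha>\<^esup>\<close>.
  \<^item> Sampling (\<open>sampling_inequality\<close>): \<open>sup \<bar>f\<bar> \<le> C (max \<bar>f(x\<^sub>i)\<bar> + h\<^sup>\<alpha> sqrt energy)\<close>.

  Comparing the volume of \<open>\<Omega>\<close> with that of the balls of radius \<open>h\<close> about the nodes gives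
  \<open>1 \<le> C sqrt n h\<^bsup>d/2\<^esup>\<close>, and multiplying by this yields the first claim. If the sets are
  quasi-uniform, then \<open>h/q\<close> is bounded and \<open>h\<close> tends to 0 because \<open>q\<close> does, and the second claim is
  the displayed bound itself.

  Stability is a spectral comparison. The quadratic form of the kernel is an integral of
  \<open>\<bar>\<Sum>a\<^sub>i cis(\<xi>\<bullet>x\<^sub>i)\<bar>\<^sup>2\<close> against the Fourier transform of \<open>\<Phi>\<close> (\<open>quadratic_form_fourier\<close>). That
  transform dominates a multiple of a rescaled product of even powers of sinc functions, which is
  the transform of a B-spline. If the support of the spline is smaller than the separation of the
  nodes, all off-diagonal terms of the smaller form vanish.

  Sampling rests on finite differences alone. Differences of order \<open>L \<ge> r\<close> with steps of length at
  most \<open>h\<close> have size at most \<open>C h\<^sup>\<alpha> sqrt energy\<close> (\<open>difference_bound\<close>), so up to such errors two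
  identities of polynomials in a shift operator \<open>T\<close> apply to \<open>f\<close>. First, \<open>(T - 1)\<^sup>L\<close> expresses \<open>f\<close> at any
  point through its values at points further along the axis of the cone at that point, about which
  \<open>\<Omega>\<close> contains balls of radius a large multiple of \<open>h\<close>. Second, modulo \<open>(T - 1)\<^sup>L\<close> the polynomial \<open>T - 1\<close> has a
  representative whose coefficients are as small as desired
  (\<open>diff_poly_power_small_remainder\<close>); hence inside such a ball the step to the nearest node changes \<open>f\<close> by at most
  a small multiple of \<open>sup \<bar>f\<bar>\<close>. That multiple is absorbed into the left-hand side.
\<close>

section \<open>Gaussian regularisation of Fourier integrals\<close>

lemma borel_measurable_cis [measurable]:
  "f \<in> borel_measurable M \<Longrightarrow> (\<lambda>x. cis (f x)) \<in> borel_measurable M"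
  by (rule borel_measurable_continuous_on[where f = cis]) (auto intro: continuous_intros)

lemma cmod_cis_minus_one: "cmod (cis t - 1) \<le> min 2 \<bar>t\<bar>"
proof -
  have 1: "cmod (cis t - 1) \<le> 2" using norm_triangle_ineq4[of "cis t" 1] by simp
  have "cmod (cis t - 1) \<le> \<bar>t\<bar>"
    using iexp_approx1[of t 0] by (simp add: cis_conv_exp)
  with 1 show ?thesis by simp
qed

lemma lborel_tensor_integral:
  fixes g :: "'a::euclidean_space \<Rightarrow> real \<Rightarrow> complex"
  assumes g: "\<And>b. b \<in> Basis \<Longrightarrow> integrable lborel (g b)"
  shows "integrable lborel (\<lambda>x. \<Prod>b\<in>Basis. g b (x \<bullet> b))"
    and "(LINT x|lborel. (\<Prod>b\<in>Basis. g b (x \<bullet> b))) = (\<Prod>b\<in>Basis. (LINT t|lborel. g b t))"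
proof -
  interpret product_sigma_finite "\<lambda>_::'a. lborel :: real measure" ..
  have [measurable]: "\<And>b. b \<in> Basis \<Longrightarrow> g b \<in> borel_measurable borel"
    using borel_measurable_integrable[OF g] by simp
  have eq: "(\<Prod>b\<in>Basis. g b ((\<Sum>c\<in>Basis. f c *\<^sub>R c) \<bullet> b)) = (\<Prod>b\<in>Basis. g b (f b))" for f
    by (intro prod.cong) simp_all
  show "integrable lborel (\<lambda>x. \<Prod>b\<in>Basis. g b (x \<bullet> b))"
    by (subst lborel_eq, subst integrable_distr_eq) (auto simp: eq intro!: product_integrable_prod g)
  show "(LINT x|lborel. (\<Prod>b\<in>Basis. g b (x \<bullet> b))) = (\<Prod>b\<in>Basis. (LINT t|lborel. g b t))"
    by (subst lborel_eq, subst integral_distr) (auto simp: eq intro!: product_integral_prod g)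
qed

lemma lborel_integral_scale:
  fixes f :: "'a::euclidean_space \<Rightarrow> 'b::{banach,second_countable_topology}"
  assumes f: "integrable lborel f" and c: "c \<noteq> 0"
  shows "integrable lborel (\<lambda>x. f (t + c *\<^sub>R x))"
    and "(LINT x|lborel. f (t + c *\<^sub>R x)) = (1 / \<bar>c\<bar> ^ DIM('a)) *\<^sub>R (LINT x|lborel. f x)"
proof -
  have [measurable]: "f \<in> borel_measurable borel"
    using borel_measurable_integrable[OF f] by simp
  define k where "k = \<bar>c\<bar> ^ DIM('a)"
  have k: "k > 0" using c by (simp add: k_def)
  have e: "(lborel::'a measure) = density (distr lborel borel (\<lambda>x. t + c *\<^sub>R x)) (\<lambda>_. ennreal k)"
    using lborel_affine[OF c, of t] by (simp add: k_def)
  have "integrable (density (distr lborel borel (\<lambda>x. t + c *\<^sub>R x)) (\<lambda>_. ennreal k)) f"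
    using f unfolding e[symmetric] .
  hence "integrable lborel (\<lambda>x. k *\<^sub>R f (t + c *\<^sub>R x))"
    using k by (subst (asm) integrable_density) (auto simp: integrable_distr_eq)
  from integrable_scaleR_right[OF this, of "inverse k"]
  show i: "integrable lborel (\<lambda>x. f (t + c *\<^sub>R x))" using k by simp
  have "(LINT x|lborel. f x) = (LINT x|density (distr lborel borel (\<lambda>x. t + c *\<^sub>R x)) (\<lambda>_. ennreal k). f x)"
    unfolding e[symmetric] ..
  also have "\<dots> = k *\<^sub>R (LINT x|lborel. f (t + c *\<^sub>R x))"
    using k by (subst integral_density) (auto simp: integral_distr)
  finally show "(LINT x|lborel. f (t + c *\<^sub>R x)) = (1 / \<bar>c\<bar> ^ DIM('a)) *\<^sub>R (LINT x|lborel. f x)"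
    using k by (simp add: k_def)
qed

lemma gaussian_fourier_1d:
  fixes u :: real
  shows "integrable lborel (\<lambda>t. complex_of_real (exp (- t\<^sup>2 / 2)) * cis (u * t))"
    and "(LINT t|lborel. complex_of_real (exp (- t\<^sup>2 / 2)) * cis (u * t))
        = complex_of_real (sqrt (2 * pi) * exp (- u\<^sup>2 / 2))"
proof -
  have d: "complex_of_real (exp (- t\<^sup>2 / 2)) * cis (u * t)
      = complex_of_real (sqrt (2 * pi)) * (std_normal_density t *\<^sub>R iexp (u * t))" for t :: real
    by (simp add: std_normal_density_def cis_conv_exp scaleR_conv_of_real)
  have i: "integrable lborel (\<lambda>t. std_normal_density t *\<^sub>R iexp (u * t))"
  proof (rule Bochner_Integration.integrable_bound)
    show "integrable lborel std_normal_density" by simp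
  qed auto
  show "integrable lborel (\<lambda>t. complex_of_real (exp (- t\<^sup>2 / 2)) * cis (u * t))"
    unfolding d using i by (intro integrable_mult_right) auto
  have "(LINT t|lborel. std_normal_density t *\<^sub>R iexp (u * t)) = complex_of_real (exp (- u\<^sup>2 / 2))"
    using char_std_normal_distribution[THEN fun_cong, of u]
    unfolding char_def by (subst (asm) integral_density) auto
  thus "(LINT t|lborel. complex_of_real (exp (- t\<^sup>2 / 2)) * cis (u * t))
        = complex_of_real (sqrt (2 * pi) * exp (- u\<^sup>2 / 2))"
    unfolding d by (subst integral_mult_right_zero) simp
qed

lemma norm_sq_eq_sum_Basis: "(norm v)\<^sup>2 = (\<Sum>b\<in>Basis. (v \<bullet> b)\<^sup>2)" for v :: "'a::euclidean_space"
  unfolding power2_norm_eq_inner by (subst euclidean_inner) (simp add: power2_eq_square)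

lemma gaussian_tensor:
  fixes \<xi> u :: "'a::euclidean_space"
  shows "complex_of_real (exp (- (norm \<xi>)\<^sup>2 / 2)) * cis (\<xi> \<bullet> u)
    = (\<Prod>b\<in>Basis. complex_of_real (exp (- (\<xi> \<bullet> b)\<^sup>2 / 2)) * cis ((u \<bullet> b) * (\<xi> \<bullet> b)))"
proof -
  have "exp (- (norm \<xi>)\<^sup>2 / 2) = (\<Prod>b\<in>Basis. exp (- (\<xi> \<bullet> b)\<^sup>2 / 2))"
    by (subst exp_sum[symmetric])
       (simp_all add: sum_negf sum_divide_distrib[symmetric] norm_sq_eq_sum_Basis)
  moreover have "cis (\<xi> \<bullet> u) = (\<Prod>b\<in>Basis. cis ((u \<bullet> b) * (\<xi> \<bullet> b)))"
    by (subst euclidean_inner) (simp add: cis_conv_exp exp_sum[symmetric] sum_distrib_left mult.commute)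
  ultimately show ?thesis by (simp add: prod.distrib)
qed

lemma gaussian_fourier:
  fixes u :: "'a::euclidean_space"
  assumes e: "\<epsilon> > 0"
  defines "G \<equiv> (\<lambda>\<xi>::'a. complex_of_real (exp (- (\<epsilon> * norm \<xi>)\<^sup>2 / 2)))"
  shows "integrable lborel (\<lambda>\<xi>. G \<xi> * cis (\<xi> \<bullet> u))"
    and "(LINT \<xi>|lborel. G \<xi> * cis (\<xi> \<bullet> u))
        = complex_of_real (sqrt (2 * pi) ^ DIM('a) * exp (- (norm u / \<epsilon>)\<^sup>2 / 2) / \<epsilon> ^ DIM('a))"
proof -
  define F where "F v \<xi> = complex_of_real (exp (- (norm \<xi>)\<^sup>2 / 2)) * cis (\<xi> \<bullet> v)" for v \<xi> :: 'a
  have F: "integrable lborel (F v)"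
    "(LINT \<xi>|lborel. F v \<xi>) = complex_of_real (sqrt (2 * pi) ^ DIM('a) * exp (- (norm v)\<^sup>2 / 2))" for v
  proof -
    note I = lborel_tensor_integral[where g = "\<lambda>b t. complex_of_real (exp (- t\<^sup>2 / 2)) * cis ((v \<bullet> b) * t)",
        OF gaussian_fourier_1d(1)]
    show "integrable lborel (F v)" using I(1) unfolding F_def gaussian_tensor .
    have "(LINT \<xi>|lborel. F v \<xi>) = (\<Prod>b\<in>Basis. complex_of_real (sqrt (2 * pi) * exp (- (v \<bullet> b)\<^sup>2 / 2)))"
      using I(2) unfolding F_def gaussian_tensor gaussian_fourier_1d(2) .
    also have "\<dots> = complex_of_real (sqrt (2 * pi) ^ DIM('a) * (\<Prod>b\<in>Basis. exp (- (v \<bullet> b)\<^sup>2 / 2)))"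
      by (simp add: prod.distrib)
    also have "(\<Prod>b\<in>Basis. exp (- (v \<bullet> b)\<^sup>2 / 2)) = exp (- (norm v)\<^sup>2 / 2)"
      by (subst exp_sum[symmetric])
         (simp_all add: sum_negf sum_divide_distrib[symmetric] norm_sq_eq_sum_Basis)
    finally show "(LINT \<xi>|lborel. F v \<xi>) = complex_of_real (sqrt (2 * pi) ^ DIM('a) * exp (- (norm v)\<^sup>2 / 2))" .
  qed
  have eq: "G \<xi> * cis (\<xi> \<bullet> u) = F (u /\<^sub>R \<epsilon>) (0 + \<epsilon> *\<^sub>R \<xi>)" for \<xi>
  proof -
    have "inverse \<epsilon> * (\<epsilon> * t) = t" for t using e by simp
    note canc = this
    show ?thesis using e by (simp add: F_def G_def canc)
  qed
  have e0: "\<epsilon> \<noteq> 0" using e by simp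
  show "integrable lborel (\<lambda>\<xi>. G \<xi> * cis (\<xi> \<bullet> u))"
    unfolding eq by (rule lborel_integral_scale(1)[OF F(1) e0])
  show "(LINT \<xi>|lborel. G \<xi> * cis (\<xi> \<bullet> u))
        = complex_of_real (sqrt (2 * pi) ^ DIM('a) * exp (- (norm u / \<epsilon>)\<^sup>2 / 2) / \<epsilon> ^ DIM('a))"
  proof -
    have n: "norm (u /\<^sub>R \<epsilon>) = norm u / \<epsilon>" using e by (simp add: field_simps)
    show ?thesis unfolding eq lborel_integral_scale(2)[OF F(1) e0] F(2) n
      using e by (simp add: scaleR_conv_of_real)
  qed
qed

lemma gaussian_integrable:
  assumes "\<epsilon> > 0"
  shows "integrable lborel (\<lambda>\<xi>::'a::euclidean_space. exp (- (\<epsilon> * norm \<xi>)\<^sup>2 / 2))"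
proof -
  have "integrable lborel (\<lambda>\<xi>::'a. complex_of_real (exp (- (\<epsilon> * norm \<xi>)\<^sup>2 / 2)))"
    using gaussian_fourier(1)[OF assms, of "0::'a"] by (simp del: of_real_exp)
  thus ?thesis unfolding complex_of_real_integrable_eq .
qed

text \<open>
  A Gaussian factor makes the inversion integral absolutely convergent, so Fubini turns it into a
  Gaussian mean. The transformed object is the image under \<open>Y\<close> of the measure with density \<open>f\<close>:
  Lebesgue measure with the identity map covers inversion for integrable functions, and a product
  of uniform measures with a summation map covers the spline below.
\<close>
lemma gaussian_regularised_inversion:
  fixes Y :: "'w \<Rightarrow> 'a::euclidean_space" and f :: "'w \<Rightarrow> complex" and x :: 'a
  assumes M: "sigma_finite_measure M" and f: "integrable M f"
    and Y[measurable]: "Y \<in> borel_measurable M" and e: "\<epsilon> > 0"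
  shows "(LINT \<xi>|lborel. (LINT w|M. f w * cis (- (\<xi> \<bullet> Y w))) * cis (\<xi> \<bullet> x)
            * complex_of_real (exp (- (\<epsilon> * norm \<xi>)\<^sup>2 / 2)))
       = (LINT w|M. f w * complex_of_real
            (sqrt (2 * pi) ^ DIM('a) * exp (- (norm (x - Y w) / \<epsilon>)\<^sup>2 / 2) / \<epsilon> ^ DIM('a)))"
proof -
  interpret sigma_finite_measure M by fact
  interpret P: pair_sigma_finite "lborel :: 'a measure" M ..
  let ?g = "\<lambda>\<xi>::'a. complex_of_real (exp (- (\<epsilon> * norm \<xi>)\<^sup>2 / 2))"
  define H where "H \<xi> w = f w * (?g \<xi> * cis (\<xi> \<bullet> (x - Y w)))" for \<xi> w
  have [measurable]: "f \<in> borel_measurable M" using f by auto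
  have int: "integrable (lborel \<Otimes>\<^sub>M M) (case_prod H)"
  proof (rule P.Fubini_integrable)
    show "case_prod H \<in> borel_measurable (lborel \<Otimes>\<^sub>M M)" unfolding H_def by measurable
    have "(LINT w|M. norm (H \<xi> w)) = (LINT w|M. norm (f w)) * exp (- (\<epsilon> * norm \<xi>)\<^sup>2 / 2)" for \<xi>
      by (simp add: H_def norm_mult del: of_real_exp)
    thus "integrable lborel (\<lambda>\<xi>. LINT w|M. norm (case_prod H (\<xi>, w)))"
      using gaussian_integrable[OF e, where 'a = 'a] by simp
    show "AE \<xi> in lborel. integrable M (\<lambda>w. case_prod H (\<xi>, w))"
    proof (rule AE_I2)
      fix \<xi> :: 'a
      have "integrable M (\<lambda>w. f w * (?g \<xi> * cis (\<xi> \<bullet> (x - Y w))))"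
        by (rule Bochner_Integration.integrable_bound[OF integrable_norm[OF f]])
           (auto simp: norm_mult intro!: mult_left_le simp del: of_real_exp)
      thus "integrable M (\<lambda>w. case_prod H (\<xi>, w))" by (simp add: H_def)
    qed
  qed
  have "(LINT w|M. f w * cis (- (\<xi> \<bullet> Y w))) * cis (\<xi> \<bullet> x) * ?g \<xi> = (LINT w|M. H \<xi> w)" for \<xi>
  proof -
    have "cis (\<xi> \<bullet> (x - Y w)) = cis (\<xi> \<bullet> x) * cis (- (\<xi> \<bullet> Y w))" for w
      by (simp add: cis_mult inner_diff_right)
    hence "H \<xi> w = (f w * cis (- (\<xi> \<bullet> Y w))) * (cis (\<xi> \<bullet> x) * ?g \<xi>)" for w
      unfolding H_def by (simp only: mult_ac)
    hence "(LINT w|M. H \<xi> w) = (LINT w|M. f w * cis (- (\<xi> \<bullet> Y w))) * (cis (\<xi> \<bullet> x) * ?g \<xi>)"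
      by (simp only: integral_mult_left_zero)
    thus ?thesis by (simp only: mult.assoc)
  qed
  note inner = this
  have swap: "(LINT \<xi>|lborel. LINT w|M. H \<xi> w) = (LINT w|M. LINT \<xi>|lborel. H \<xi> w)"
    by (rule P.Fubini_integral[OF int, symmetric])
  have outer: "(LINT \<xi>|lborel. H \<xi> w) = f w * complex_of_real
            (sqrt (2 * pi) ^ DIM('a) * exp (- (norm (x - Y w) / \<epsilon>)\<^sup>2 / 2) / \<epsilon> ^ DIM('a))" for w
    unfolding H_def integral_mult_right_zero gaussian_fourier(2)[OF e] ..
  show ?thesis unfolding inner swap outer ..
qed

lemma gaussian_regularisation_tendsto:
  fixes F :: "'b::euclidean_space \<Rightarrow> complex"
  assumes F: "integrable lborel F"
  shows "(\<lambda>n. LINT \<xi>|lborel. F \<xi> * complex_of_real (exp (- (inverse (real (Suc n)) * norm \<xi>)\<^sup>2 / 2)))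
     \<longlonglongrightarrow> (LINT \<xi>|lborel. F \<xi>)"
proof (rule integral_dominated_convergence[where w = "\<lambda>\<xi>. norm (F \<xi>)"])
  have [measurable]: "F \<in> borel_measurable borel" using F by auto
  show "F \<in> borel_measurable lborel" by simp
  show "(\<lambda>\<xi>. F \<xi> * complex_of_real (exp (- (inverse (real (Suc n)) * norm \<xi>)\<^sup>2 / 2))) \<in> borel_measurable lborel" for n
    by measurable
  show "integrable lborel (\<lambda>\<xi>. norm (F \<xi>))" using F by simp
  show "AE \<xi> in lborel. (\<lambda>n. F \<xi> * complex_of_real (exp (- (inverse (real (Suc n)) * norm \<xi>)\<^sup>2 / 2))) \<longlonglongrightarrow> F \<xi>"
  proof (rule AE_I2)
    fix \<xi> :: 'b
    have "(\<lambda>n. F \<xi> * complex_of_real (exp (- (inverse (real (Suc n)) * norm \<xi>)\<^sup>2 / 2)))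
        \<longlonglongrightarrow> F \<xi> * complex_of_real (exp (- (0 * norm \<xi>)\<^sup>2 / 2))"
      by (intro tendsto_intros LIMSEQ_inverse_real_of_nat) auto
    thus "(\<lambda>n. F \<xi> * complex_of_real (exp (- (inverse (real (Suc n)) * norm \<xi>)\<^sup>2 / 2))) \<longlonglongrightarrow> F \<xi>" by simp
  qed
  show "AE \<xi> in lborel. norm (F \<xi> * complex_of_real (exp (- (inverse (real (Suc n)) * norm \<xi>)\<^sup>2 / 2))) \<le> norm (F \<xi>)" for n
    by (auto simp: norm_mult intro!: mult_left_le simp del: of_real_exp)
qed

text \<open>
  Expanding the squared modulus produces the differences of nodes. The weight \<open>w\<close> is arbitrary since
  the spectrum of the kernel is compared below with that of a spline.
\<close>
lemma quadratic_form_integral: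
  fixes y :: "'i \<Rightarrow> 'a::euclidean_space" and c :: "'i \<Rightarrow> real" and w :: "'a \<Rightarrow> real"
  assumes w: "integrable lborel w" and I: "finite I"
  shows "integrable lborel (\<lambda>\<xi>. w \<xi> * (cmod (\<Sum>i\<in>I. complex_of_real (c i) * cis (\<xi> \<bullet> y i)))\<^sup>2)"
    and "complex_of_real (LINT \<xi>|lborel. w \<xi> * (cmod (\<Sum>i\<in>I. complex_of_real (c i) * cis (\<xi> \<bullet> y i)))\<^sup>2)
      = (\<Sum>i\<in>I. \<Sum>j\<in>I. complex_of_real (c i * c j)
          * (LINT \<xi>|lborel. complex_of_real (w \<xi>) * cis (\<xi> \<bullet> (y i - y j))))"
proof -
  have [measurable]: "w \<in> borel_measurable borel" using w by auto
  have wi: "integrable lborel (\<lambda>\<xi>. complex_of_real (w \<xi>) * cis (\<xi> \<bullet> z))" for z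
    by (rule Bochner_Integration.integrable_bound[OF w]) (auto simp: norm_mult)
  have cd: "cis (\<xi> \<bullet> (y i - y j)) = cis (\<xi> \<bullet> y i) * cnj (cis (\<xi> \<bullet> y j))" for \<xi> i j
    by (simp add: cis_cnj cis_mult inner_diff_right)
  have eq: "complex_of_real ((cmod (\<Sum>i\<in>I. complex_of_real (c i) * cis (\<xi> \<bullet> y i)))\<^sup>2)
      = (\<Sum>i\<in>I. \<Sum>j\<in>I. complex_of_real (c i * c j) * cis (\<xi> \<bullet> (y i - y j)))" for \<xi>
    unfolding complex_norm_square cd by (simp add: sum_product mult_ac)
  have eq': "complex_of_real (w \<xi> * (cmod (\<Sum>i\<in>I. complex_of_real (c i) * cis (\<xi> \<bullet> y i)))\<^sup>2)
      = (\<Sum>i\<in>I. \<Sum>j\<in>I. complex_of_real (c i * c j) * (complex_of_real (w \<xi>) * cis (\<xi> \<bullet> (y i - y j))))" for \<xi>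
    unfolding of_real_mult[of "w \<xi>"] eq by (simp add: sum_distrib_left mult_ac)
  define Q where "Q \<xi> = w \<xi> * (cmod (\<Sum>i\<in>I. complex_of_real (c i) * cis (\<xi> \<bullet> y i)))\<^sup>2" for \<xi>
  have b: "has_bochner_integral lborel (\<lambda>\<xi>. complex_of_real (Q \<xi>))
     (\<Sum>i\<in>I. \<Sum>j\<in>I. complex_of_real (c i * c j) * (LINT \<xi>|lborel. complex_of_real (w \<xi>) * cis (\<xi> \<bullet> (y i - y j))))"
    unfolding Q_def eq'
    by (intro has_bochner_integral_sum has_bochner_integral_mult_right has_bochner_integral_integrable wi)
  show "integrable lborel (\<lambda>\<xi>. w \<xi> * (cmod (\<Sum>i\<in>I. complex_of_real (c i) * cis (\<xi> \<bullet> y i)))\<^sup>2)"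
    using b unfolding has_bochner_integral_iff complex_of_real_integrable_eq Q_def by blast
  show "complex_of_real (LINT \<xi>|lborel. w \<xi> * (cmod (\<Sum>i\<in>I. complex_of_real (c i) * cis (\<xi> \<bullet> y i)))\<^sup>2)
      = (\<Sum>i\<in>I. \<Sum>j\<in>I. complex_of_real (c i * c j)
          * (LINT \<xi>|lborel. complex_of_real (w \<xi>) * cis (\<xi> \<bullet> (y i - y j))))"
    using b unfolding has_bochner_integral_iff integral_complex_of_real Q_def by blast
qed

section \<open>Kernels with algebraically decaying spectrum\<close>

locale sobolev_kernel =
  fixes \<Phi> :: "'a::euclidean_space \<Rightarrow> real" and r c1 c2 :: real
  assumes cont: "continuous_on UNIV \<Phi>"
    and int: "integrable lborel \<Phi>"
    and pos_def: "positive_definite_function \<Phi>"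
    and r: "r > real DIM('a) / 2" and c1: "c1 > 0" and c2: "c2 > 0"
    and lower: "\<And>\<xi>. complex_of_real (c1 * (1 + (norm \<xi>)\<^sup>2) powr (- r)) \<le> fourier_transform \<Phi> \<xi>"
    and upper: "\<And>\<xi>. fourier_transform \<Phi> \<xi> \<le> complex_of_real (c2 * (1 + (norm \<xi>)\<^sup>2) powr (- r))"
begin

definition \<rho> :: "'a \<Rightarrow> real" where "\<rho> \<xi> = Re (fourier_transform \<Phi> \<xi>)"

definition \<kappa> :: real where "\<kappa> = 1 / sqrt (2 * pi) ^ DIM('a)"

text \<open>The symbol of the Bessel potential of order \<open>2r\<close>, to which the spectrum is comparable.\<close>
definition bessel_weight :: "'a \<Rightarrow> real" where "bessel_weight \<xi> = (1 + (norm \<xi>)\<^sup>2) powr (- r)"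

lemma r_pos: "r > 0" using r by (rule le_less_trans[rotated]) simp

lemma \<kappa>_pos: "\<kappa> > 0" by (simp add: \<kappa>_def)

lemma \<kappa>_eq_powr: "(2 * pi) powr (- real DIM('a) / 2) = \<kappa>"
proof -
  have "(2 * pi) powr (- real DIM('a) / 2) = inverse ((2 * pi) powr (1/2 * real DIM('a)))"
    by (simp add: powr_minus[symmetric])
  also have "(2 * pi) powr (1/2 * real DIM('a)) = sqrt (2 * pi) ^ DIM('a)"
    by (simp only: powr_powr[symmetric] powr_half_sqrt) (simp add: powr_half_sqrt powr_realpow)
  finally show ?thesis by (simp add: \<kappa>_def inverse_eq_divide)
qed

lemma bessel_weight_pos: "bessel_weight \<xi> > 0"
  using add_pos_nonneg[of 1 "(norm \<xi>)\<^sup>2"] by (simp add: bessel_weight_def)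

lemma \<rho>_bounds: "c1 * bessel_weight \<xi> \<le> \<rho> \<xi>" "\<rho> \<xi> \<le> c2 * bessel_weight \<xi>"
  using lower[of \<xi>] upper[of \<xi>] by (auto simp: less_eq_complex_def \<rho>_def bessel_weight_def)

lemma \<rho>_nonneg: "0 \<le> \<rho> \<xi>"
  using \<rho>_bounds(1)[of \<xi>] bessel_weight_pos[of \<xi>] c1 by (smt (verit) mult_pos_pos)

lemma of_real_\<rho>: "complex_of_real (\<rho> \<xi>) = fourier_transform \<Phi> \<xi>"
  using lower[of \<xi>] by (intro complex_eqI) (auto simp: less_eq_complex_def \<rho>_def)

lemma \<rho>_integral: "complex_of_real (\<rho> \<xi>)
    = complex_of_real \<kappa> * (LINT y|lborel. complex_of_real (\<Phi> y) * cis (- (\<xi> \<bullet> y)))"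
  unfolding of_real_\<rho> fourier_transform_def \<kappa>_eq_powr
  by (simp add: cis_conv_exp)

lemma measurable_\<Phi> [measurable]: "\<Phi> \<in> borel_measurable borel"
  using int by auto

lemma measurable_\<rho> [measurable]: "\<rho> \<in> borel_measurable borel"
  unfolding \<rho>_def fourier_transform_def by measurable

lemma measurable_bessel_weight [measurable]: "bessel_weight \<in> borel_measurable borel"
  unfolding bessel_weight_def by measurable

lemma \<Phi>_even: "\<Phi> (- x) = \<Phi> x"
  using pos_def by (simp add: positive_definite_function_def)

lemma quadratic_form_pos:
  "finite P \<Longrightarrow> \<exists>p\<in>P. c p \<noteq> 0 \<Longrightarrow> 0 < (\<Sum>p\<in>P. \<Sum>q\<in>P. c p * c q * \<Phi> (p - q))"
  using pos_def unfolding positive_definite_function_def by blast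

lemma abs_\<Phi>_le: "\<bar>\<Phi> x\<bar> \<le> \<Phi> 0"
proof (cases "x = 0")
  case True
  have "0 < (\<Sum>p\<in>{0::'a}. \<Sum>q\<in>{0}. 1 * 1 * \<Phi> (p - q))"
    by (rule quadratic_form_pos[of "{0}" "\<lambda>_. 1"]) auto
  with True show ?thesis by simp
next
  case False
  define c :: "real \<Rightarrow> 'a \<Rightarrow> real" where "c s p = (if p = 0 then 1 else s)" for s p
  have "0 < (\<Sum>p\<in>{0, x}. \<Sum>q\<in>{0, x}. c s p * c s q * \<Phi> (p - q))" for s
    by (rule quadratic_form_pos) (auto simp: c_def)
  from this[of 1] this[of "-1"] show ?thesis using False \<Phi>_even[of x] by (simp add: c_def)
qed

text \<open>
  The substitution \<open>y = x + \<epsilon>s\<close> concentrates the Gaussian at \<open>x\<close>, and \<open>\<bar>\<Phi>\<bar> \<le> \<Phi> 0\<close> provides a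
  dominating function that does not depend on \<open>\<epsilon>\<close>.
\<close>
lemma gaussian_mean_tendsto:
  "(\<lambda>n. LINT s|lborel. \<Phi> (x + inverse (real (Suc n)) *\<^sub>R s) * exp (- (norm s)\<^sup>2 / 2)) \<longlonglongrightarrow> \<Phi> x / \<kappa>"
proof -
  have gi: "integrable lborel (\<lambda>s::'a. exp (- (norm s)\<^sup>2 / 2))"
    using gaussian_integrable[of 1, where 'a = 'a] by simp
  have g: "(LINT s|lborel. exp (- (norm (s::'a))\<^sup>2 / 2)) = 1 / \<kappa>"
  proof -
    have "complex_of_real (LINT s|lborel. exp (- (norm (s::'a))\<^sup>2 / 2)) = complex_of_real (1 / \<kappa>)"
      using gaussian_fourier(2)[of 1 "0::'a"] unfolding integral_complex_of_real[symmetric]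
      by (simp add: \<kappa>_def del: of_real_exp)
    thus ?thesis using of_real_eq_iff by blast
  qed
  have "(\<lambda>n. LINT s|lborel. \<Phi> (x + inverse (real (Suc n)) *\<^sub>R s) * exp (- (norm s)\<^sup>2 / 2))
      \<longlonglongrightarrow> (LINT s|lborel. \<Phi> x * exp (- (norm (s::'a))\<^sup>2 / 2))"
  proof (rule integral_dominated_convergence)
    show "integrable lborel (\<lambda>s::'a. \<Phi> 0 * exp (- (norm s)\<^sup>2 / 2))" using gi by simp
    show "AE s in lborel. (\<lambda>n. \<Phi> (x + inverse (real (Suc n)) *\<^sub>R s) * exp (- (norm s)\<^sup>2 / 2))
        \<longlonglongrightarrow> \<Phi> x * exp (- (norm s)\<^sup>2 / 2)"
    proof (rule AE_I2)
      fix s :: 'a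
      have "(\<lambda>n. x + inverse (real (Suc n)) *\<^sub>R s) \<longlonglongrightarrow> x + 0 *\<^sub>R s"
        by (intro tendsto_intros LIMSEQ_inverse_real_of_nat)
      moreover have "isCont \<Phi> x" using cont by (simp add: continuous_on_eq_continuous_at)
      ultimately have "(\<lambda>n. \<Phi> (x + inverse (real (Suc n)) *\<^sub>R s)) \<longlonglongrightarrow> \<Phi> x"
        by (intro isCont_tendsto_compose[where g = \<Phi>]) auto
      thus "(\<lambda>n. \<Phi> (x + inverse (real (Suc n)) *\<^sub>R s) * exp (- (norm s)\<^sup>2 / 2))
        \<longlonglongrightarrow> \<Phi> x * exp (- (norm s)\<^sup>2 / 2)" by (rule tendsto_mult_right)
    qed
    show "AE s in lborel. norm (\<Phi> (x + inverse (real (Suc n)) *\<^sub>R s) * exp (- (norm s)\<^sup>2 / 2))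
        \<le> \<Phi> 0 * exp (- (norm s)\<^sup>2 / 2)" for n
      by (auto simp: abs_mult intro!: mult_right_mono abs_\<Phi>_le)
  qed measurable
  moreover have "(LINT s|lborel. \<Phi> x * exp (- (norm (s::'a))\<^sup>2 / 2)) = \<Phi> x / \<kappa>"
    by (simp only: integral_mult_right_zero g) simp
  ultimately show ?thesis by (simp only:)
qed

lemma regularised_inversion:
  assumes e: "\<epsilon> > 0"
  shows "(LINT \<xi>|lborel. complex_of_real (\<rho> \<xi>) * cis (\<xi> \<bullet> x) * complex_of_real (exp (- (\<epsilon> * norm \<xi>)\<^sup>2 / 2)))
    = complex_of_real (LINT s|lborel. \<Phi> (x + \<epsilon> *\<^sub>R s) * exp (- (norm s)\<^sup>2 / 2))"
proof -
  let ?I = "LINT \<xi>|lborel. (LINT y|lborel. complex_of_real (\<Phi> y) * cis (- (\<xi> \<bullet> y))) * cis (\<xi> \<bullet> x)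
      * complex_of_real (exp (- (\<epsilon> * norm \<xi>)\<^sup>2 / 2))"
  let ?F = "\<lambda>y. \<Phi> y * exp (- (norm (x - y) / \<epsilon>)\<^sup>2 / 2)"
  have F: "integrable lborel ?F"
    by (rule Bochner_Integration.integrable_bound[OF int]) (auto simp: abs_mult intro!: mult_left_le)
  have sc: "(LINT s|lborel. \<Phi> (x + \<epsilon> *\<^sub>R s) * exp (- (norm s)\<^sup>2 / 2)) = (1 / \<epsilon> ^ DIM('a)) * (LINT y|lborel. ?F y)"
    using lborel_integral_scale(2)[OF F, of \<epsilon> x] e by simp
  have "?I = (LINT y|lborel. complex_of_real (\<Phi> y) * complex_of_real
            (sqrt (2 * pi) ^ DIM('a) * exp (- (norm (x - y) / \<epsilon>)\<^sup>2 / 2) / \<epsilon> ^ DIM('a)))"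
    by (rule gaussian_regularised_inversion[where Y = "\<lambda>y. y"])
       (use int e in \<open>auto intro!: sigma_finite_lborel integrable_of_real\<close>)
  also have "\<dots> = (LINT y|lborel. complex_of_real ((1 / (\<kappa> * \<epsilon> ^ DIM('a))) * ?F y))"
    by (intro Bochner_Integration.integral_cong) (auto simp: \<kappa>_def)
  also have "\<dots> = complex_of_real ((1 / (\<kappa> * \<epsilon> ^ DIM('a))) * (LINT y|lborel. ?F y))"
    unfolding integral_complex_of_real by simp
  also have "\<dots> = complex_of_real ((1 / \<kappa>) * (LINT s|lborel. \<Phi> (x + \<epsilon> *\<^sub>R s) * exp (- (norm s)\<^sup>2 / 2)))"
    unfolding sc by simp
  finally have I: "?I = \<dots>" .
  have "(LINT \<xi>|lborel. complex_of_real (\<rho> \<xi>) * cis (\<xi> \<bullet> x) * complex_of_real (exp (- (\<epsilon> * norm \<xi>)\<^sup>2 / 2)))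
      = complex_of_real \<kappa> * ?I"
    unfolding \<rho>_integral mult.assoc integral_mult_right_zero ..
  thus ?thesis using \<kappa>_pos unfolding I by simp
qed

text \<open>
  The regularised integrals of the nonnegative spectrum increase to a finite limit, namely
  \<open>\<Phi> 0 / \<kappa>\<close>. This also yields integrability of the Bessel weight without any computation in polar
  coordinates.
\<close>
lemma \<rho>_integrable: "integrable lborel \<rho>"
proof -
  define g where "g n \<xi> = exp (- (inverse (real (Suc n)) * norm (\<xi>::'a))\<^sup>2 / 2)" for n \<xi>
  have g_le: "g n \<xi> \<le> 1" "0 \<le> g n \<xi>" for n \<xi> by (auto simp: g_def)
  have [measurable]: "g n \<in> borel_measurable borel" for n unfolding g_def by measurable
  show ?thesis
  proof (rule integrable_monotone_convergence)
    show "integrable lborel (\<lambda>\<xi>. \<rho> \<xi> * g n \<xi>)" for n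
    proof (rule Bochner_Integration.integrable_bound)
      show "integrable lborel (\<lambda>\<xi>. c2 * g n \<xi>)"
        unfolding g_def by (intro integrable_mult_right gaussian_integrable) auto
      have "\<rho> \<xi> \<le> c2" for \<xi>
      proof -
        have "bessel_weight \<xi> \<le> 1" unfolding bessel_weight_def using r_pos
          powr_mono[of "- r" 0 "1 + (norm \<xi>)\<^sup>2"] by (simp add: add_nonneg_eq_0_iff)
        thus ?thesis using \<rho>_bounds(2)[of \<xi>] c2 by (smt (verit) mult_left_le)
      qed
      thus "AE \<xi> in lborel. norm (\<rho> \<xi> * g n \<xi>) \<le> norm (c2 * g n \<xi>)"
        using c2 g_le by (auto simp: abs_mult \<rho>_nonneg intro!: mult_right_mono)
    qed measurable
    show "AE \<xi> in lborel. mono (\<lambda>n. \<rho> \<xi> * g n \<xi>)"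
    proof (rule AE_I2, rule monoI)
      fix \<xi> :: 'a and n m :: nat assume "n \<le> m"
      hence "inverse (real (Suc m)) \<le> inverse (real (Suc n))" by (intro le_imp_inverse_le) auto
      hence "(inverse (real (Suc m)) * norm \<xi>)\<^sup>2 \<le> (inverse (real (Suc n)) * norm \<xi>)\<^sup>2"
        by (intro power_mono mult_right_mono) auto
      hence "g n \<xi> \<le> g m \<xi>" by (simp add: g_def)
      thus "\<rho> \<xi> * g n \<xi> \<le> \<rho> \<xi> * g m \<xi>" by (intro mult_left_mono \<rho>_nonneg)
    qed
    show "AE \<xi> in lborel. (\<lambda>n. \<rho> \<xi> * g n \<xi>) \<longlonglongrightarrow> \<rho> \<xi>"
    proof (rule AE_I2)
      fix \<xi>
      have "(\<lambda>n. \<rho> \<xi> * g n \<xi>) \<longlonglongrightarrow> \<rho> \<xi> * exp (- (0 * norm \<xi>)\<^sup>2 / 2)"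
        unfolding g_def by (intro tendsto_intros LIMSEQ_inverse_real_of_nat) auto
      thus "(\<lambda>n. \<rho> \<xi> * g n \<xi>) \<longlonglongrightarrow> \<rho> \<xi>" by simp
    qed
    have eq: "(LINT \<xi>|lborel. \<rho> \<xi> * g n \<xi>)
        = (LINT s|lborel. \<Phi> (0 + inverse (real (Suc n)) *\<^sub>R s) * exp (- (norm s)\<^sup>2 / 2))" for n
    proof -
      have "complex_of_real (LINT \<xi>|lborel. \<rho> \<xi> * g n \<xi>) = (LINT \<xi>|lborel. complex_of_real (\<rho> \<xi> * g n \<xi>))"
        by (rule integral_complex_of_real[symmetric])
      also have "\<dots> = (LINT \<xi>|lborel. complex_of_real (\<rho> \<xi>) * cis (\<xi> \<bullet> 0)
          * complex_of_real (exp (- (inverse (real (Suc n)) * norm \<xi>)\<^sup>2 / 2)))"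
        by (simp add: g_def)
      also have "\<dots> = complex_of_real (LINT s|lborel. \<Phi> (0 + inverse (real (Suc n)) *\<^sub>R s) * exp (- (norm s)\<^sup>2 / 2))"
        by (rule regularised_inversion) simp
      finally show ?thesis by (simp only: of_real_eq_iff)
    qed
    show "(\<lambda>n. LINT \<xi>|lborel. \<rho> \<xi> * g n \<xi>) \<longlonglongrightarrow> \<Phi> 0 / \<kappa>"
      unfolding eq by (rule gaussian_mean_tendsto)
  qed measurable
qed

lemma bessel_weight_integrable: "integrable lborel bessel_weight"
proof (rule Bochner_Integration.integrable_bound)
  show "integrable lborel (\<lambda>\<xi>. inverse c1 * \<rho> \<xi>)" using \<rho>_integrable by simp
  show "AE \<xi> in lborel. norm (bessel_weight \<xi>) \<le> norm (inverse c1 * \<rho> \<xi>)"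
    using \<rho>_bounds(1) c1 \<rho>_nonneg less_imp_le[OF bessel_weight_pos] by (auto simp: field_simps)
qed measurable

lemma \<rho>_cis_integrable: "integrable lborel (\<lambda>\<xi>. complex_of_real (\<rho> \<xi>) * cis (\<xi> \<bullet> x))"
  by (rule Bochner_Integration.integrable_bound[OF \<rho>_integrable]) (auto simp: norm_mult)

lemma \<Phi>_inversion: "complex_of_real (\<Phi> x) = complex_of_real \<kappa> * (LINT \<xi>|lborel. complex_of_real (\<rho> \<xi>) * cis (\<xi> \<bullet> x))"
proof -
  let ?J = "\<lambda>n. LINT \<xi>|lborel. complex_of_real (\<rho> \<xi>) * cis (\<xi> \<bullet> x)
      * complex_of_real (exp (- (inverse (real (Suc n)) * norm \<xi>)\<^sup>2 / 2))"
  have "?J \<longlonglongrightarrow> (LINT \<xi>|lborel. complex_of_real (\<rho> \<xi>) * cis (\<xi> \<bullet> x))"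
    by (rule gaussian_regularisation_tendsto[OF \<rho>_cis_integrable])
  moreover have "?J \<longlonglongrightarrow> complex_of_real (\<Phi> x / \<kappa>)"
  proof -
    have "?J n = complex_of_real (LINT s|lborel. \<Phi> (x + inverse (real (Suc n)) *\<^sub>R s) * exp (- (norm s)\<^sup>2 / 2))" for n
      by (rule regularised_inversion) simp
    thus ?thesis using gaussian_mean_tendsto[of x] by (simp only: tendsto_of_real_iff)
  qed
  ultimately have "(LINT \<xi>|lborel. complex_of_real (\<rho> \<xi>) * cis (\<xi> \<bullet> x)) = complex_of_real (\<Phi> x / \<kappa>)"
    by (rule LIMSEQ_unique)
  thus ?thesis using \<kappa>_pos by simp
qed

lemma quadratic_form_fourier:
  fixes y :: "'i \<Rightarrow> 'a" and c :: "'i \<Rightarrow> real"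
  assumes I: "finite I"
  shows "integrable lborel (\<lambda>\<xi>. \<rho> \<xi> * (cmod (\<Sum>i\<in>I. complex_of_real (c i) * cis (\<xi> \<bullet> y i)))\<^sup>2)"
    and "(\<Sum>i\<in>I. \<Sum>j\<in>I. c i * c j * \<Phi> (y i - y j))
      = \<kappa> * (LINT \<xi>|lborel. \<rho> \<xi> * (cmod (\<Sum>i\<in>I. complex_of_real (c i) * cis (\<xi> \<bullet> y i)))\<^sup>2)"
proof -
  show "integrable lborel (\<lambda>\<xi>. \<rho> \<xi> * (cmod (\<Sum>i\<in>I. complex_of_real (c i) * cis (\<xi> \<bullet> y i)))\<^sup>2)"
    by (rule quadratic_form_integral(1)[OF \<rho>_integrable I])
  have "(LINT \<xi>|lborel. complex_of_real (\<rho> \<xi>) * cis (\<xi> \<bullet> z)) = complex_of_real (\<Phi> z / \<kappa>)" for z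
    using \<Phi>_inversion[of z] \<kappa>_pos by (simp add: field_simps)
  hence "complex_of_real (LINT \<xi>|lborel. \<rho> \<xi> * (cmod (\<Sum>i\<in>I. complex_of_real (c i) * cis (\<xi> \<bullet> y i)))\<^sup>2)
      = complex_of_real ((\<Sum>i\<in>I. \<Sum>j\<in>I. c i * c j * \<Phi> (y i - y j)) / \<kappa>)"
    unfolding quadratic_form_integral(2)[OF \<rho>_integrable I] by (simp add: sum_divide_distrib)
  hence "(LINT \<xi>|lborel. \<rho> \<xi> * (cmod (\<Sum>i\<in>I. complex_of_real (c i) * cis (\<xi> \<bullet> y i)))\<^sup>2)
      = (\<Sum>i\<in>I. \<Sum>j\<in>I. c i * c j * \<Phi> (y i - y j)) / \<kappa>"
    unfolding of_real_eq_iff .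
  thus "(\<Sum>i\<in>I. \<Sum>j\<in>I. c i * c j * \<Phi> (y i - y j))
      = \<kappa> * (LINT \<xi>|lborel. \<rho> \<xi> * (cmod (\<Sum>i\<in>I. complex_of_real (c i) * cis (\<xi> \<bullet> y i)))\<^sup>2)"
    using \<kappa>_pos by simp
qed

end

section \<open>The spectrum of a tensor-product B-spline\<close>

text \<open>
  The transform of a tensor-product B-spline with support \<open>[-2m, 2m]\<^sup>d\<close>, up to normalisation. The
  even exponent makes it nonnegative.
\<close>
definition sinc_product :: "nat \<Rightarrow> 'a::euclidean_space \<Rightarrow> real" where
  "sinc_product m \<eta> = (\<Prod>b\<in>Basis. (2 * sinc (\<eta> \<bullet> b)) ^ (2 * m))"

lemma interval_fourier:
  "(LINT t|restrict_space lborel {-1..1}. cis (- (s * t))) = complex_of_real (2 * sinc s)"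
proof -
  have "(LINT t|restrict_space lborel {-1..1}. cis (- (s * t)))
      = (LINT t|lborel. indicator {-1..1} t *\<^sub>R cis (- (s * t)))"
    by (subst integral_restrict_space) (auto simp: set_lebesgue_integral_def)
  also have "\<dots> = complex_of_real (2 * sinc s)"
  proof (cases "s = 0")
    case True
    thus ?thesis by (simp add: scaleR_conv_of_real)
  next
    case False
    define F where "F t = (\<i> / complex_of_real s) * cis (- (s * t))" for t
    have F: "(F has_vector_derivative cis (- (s * t))) (at t within {-1..1})" for t
    proof -
      have "((\<lambda>z. (\<i> / complex_of_real s) * exp (- (\<i> * complex_of_real s * z)))
          has_field_derivative exp (- (\<i> * complex_of_real s * complex_of_real t))) (at (complex_of_real t))"
        using False by (auto intro!: derivative_eq_intros)
      hence "((\<lambda>x. (\<i> / complex_of_real s) * exp (- (\<i> * complex_of_real s * complex_of_real x)))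
          has_vector_derivative exp (- (\<i> * complex_of_real s * complex_of_real t))) (at t within {-1..1})"
        by (rule has_vector_derivative_real_field)
      thus ?thesis unfolding F_def cis_conv_exp by (simp add: mult.assoc)
    qed
    have "(LINT t|lborel. indicator {-1..1} t *\<^sub>R cis (- (s * t))) = F 1 - F (-1)"
      by (rule integral_FTC_atLeastAtMost) (auto intro!: F continuous_intros)
    also have "\<dots> = complex_of_real (2 * sinc s)"
    proof -
      have "cis (- s) - cis s = - (2 * \<i> * complex_of_real (sin s))" by (rule complex_eqI) auto
      moreover have "F 1 - F (-1) = (\<i> / complex_of_real s) * (cis (- s) - cis s)"
        by (simp add: F_def right_diff_distrib)
      moreover have "\<i> * (2 * \<i> * z) = - (2 * z)" for z by (simp add: complex_eq_iff)
      ultimately show ?thesis using False by simp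
    qed
    finally show ?thesis .
  qed
  finally show ?thesis .
qed

lemma cis_neg_sum: "finite A \<Longrightarrow> cis (- (\<Sum>i\<in>A. f i)) = (\<Prod>i\<in>A. cis (- f i))"
proof (induction A rule: finite_induct)
  case (insert a A)
  have "cis (- (f a + sum f A)) = cis (- f a) * cis (- sum f A)" by (simp add: cis_mult)
  thus ?case using insert by (simp only: sum.insert prod.insert not_False_eq_True)
qed simp

text \<open>
  The spline is the density of a sum of \<open>2m\<close> independent uniform variables in each coordinate, so
  its transform is realised as that of the coordinate sum \<open>Y\<close> on a product measure. The
  bound on \<open>Y\<close> expresses that the spline has compact support.
\<close>
lemma sinc_product_fourier:
  fixes m :: nat
  shows "\<exists>(M :: (nat \<times> 'a::euclidean_space \<Rightarrow> real) measure) Y.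
    sigma_finite_measure M \<and> integrable M (\<lambda>_. 1 :: complex) \<and> Y \<in> borel_measurable M \<and>
    (\<forall>\<omega>\<in>space M. \<forall>b\<in>Basis. \<bar>Y \<omega> \<bullet> b\<bar> \<le> 2 * real m) \<and>
    (\<forall>\<eta> :: 'a. (LINT \<omega>|M. 1 * cis (- (\<eta> \<bullet> Y \<omega>))) = complex_of_real (sinc_product m \<eta>))"
proof -
  define U :: "real measure" where "U = restrict_space lborel {-1..1}"
  have fU: "finite_measure U"
    by (rule finite_measureI) (simp add: U_def emeasure_restrict_space space_restrict_space)
  interpret U: finite_measure U by (rule fU)
  interpret product_sigma_finite "\<lambda>_::nat \<times> 'a. U" ..
  define J :: "(nat \<times> 'a) set" where "J = {..<2 * m} \<times> Basis"
  define M where "M = Pi\<^sub>M J (\<lambda>_. U)"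
  define Y where "Y \<omega> = (\<Sum>p\<in>J. \<omega> p *\<^sub>R snd p)" for \<omega> :: "nat \<times> 'a \<Rightarrow> real"
  have J: "finite J" by (simp add: J_def)
  have spU: "space U = {-1..1}" by (simp add: U_def space_restrict_space)
  have idU [measurable]: "(\<lambda>t. t) \<in> borel_measurable U" unfolding U_def by (rule measurable_restrict_space1) simp
  show ?thesis
  proof (rule exI[of _ M], rule exI[of _ Y], intro conjI ballI allI)
    show "sigma_finite_measure M" unfolding M_def by (rule sigma_finite[OF J])
    have "integrable M (\<lambda>\<omega>. \<Prod>p\<in>J. 1 :: complex)"
      unfolding M_def by (rule product_integrable_prod[OF J]) simp
    thus "integrable M (\<lambda>_. 1 :: complex)" by simp
    have [measurable]: "(\<lambda>\<omega>. \<omega> p) \<in> borel_measurable M" if "p \<in> J" for p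
    proof -
      have "(\<lambda>\<omega>. \<omega> p) \<in> M \<rightarrow>\<^sub>M U" unfolding M_def using that by (rule measurable_component_singleton)
      from measurable_compose[OF this idU] show ?thesis .
    qed
    show "Y \<in> borel_measurable M"
      unfolding Y_def by measurable
    fix \<omega> and b :: 'a assume w: "\<omega> \<in> space M" and b: "b \<in> Basis"
    have w1: "\<bar>\<omega> p\<bar> \<le> 1" if "p \<in> J" for p
      using w that unfolding M_def space_PiM spU by (auto simp: PiE_iff abs_le_iff)
    have "\<bar>Y \<omega> \<bullet> b\<bar> \<le> (\<Sum>p\<in>J. \<bar>\<omega> p * (snd p \<bullet> b)\<bar>)"
      unfolding Y_def inner_sum_left inner_scaleR_left by (rule sum_abs)
    also have "\<dots> \<le> (\<Sum>p\<in>J. 1 * \<bar>snd p \<bullet> b\<bar>)"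
      unfolding abs_mult by (intro sum_mono mult_right_mono w1) auto
    also have "\<dots> = (\<Sum>i<2 * m. \<Sum>c\<in>Basis. \<bar>c \<bullet> b\<bar>)"
      unfolding J_def by (subst sum.cartesian_product) (simp add: case_prod_beta)
    also have "(\<Sum>c\<in>Basis. \<bar>c \<bullet> b\<bar>) = (\<Sum>c\<in>Basis. if c = b then 1 else 0)"
      using b by (intro sum.cong) (auto simp: inner_Basis)
    finally show "\<bar>Y \<omega> \<bullet> b\<bar> \<le> 2 * real m" using b by simp
  next
    fix \<eta> :: 'a
    have iU: "integrable U (\<lambda>t. cis (- (s * t)))" for s
    proof (rule U.integrable_const_bound[where B = 1])
      show "(\<lambda>t. cis (- (s * t))) \<in> borel_measurable U" by measurable
    qed simp
    have "cis (- (\<eta> \<bullet> Y \<omega>)) = (\<Prod>p\<in>J. cis (- ((\<eta> \<bullet> snd p) * \<omega> p)))" for \<omega>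
      unfolding Y_def inner_sum_right cis_neg_sum[OF J] by (simp add: mult.commute)
    hence "(LINT \<omega>|M. 1 * cis (- (\<eta> \<bullet> Y \<omega>))) = (LINT \<omega>|M. (\<Prod>p\<in>J. cis (- ((\<eta> \<bullet> snd p) * \<omega> p))))"
      by (simp only: mult_1)
    also have "\<dots> = (\<Prod>p\<in>J. (LINT t|U. cis (- ((\<eta> \<bullet> snd p) * t))))"
      unfolding M_def
      by (rule product_integral_prod[OF J, where f = "\<lambda>p t. cis (- ((\<eta> \<bullet> snd p) * t))"]) (rule iU)
    also have "\<dots> = (\<Prod>p\<in>J. complex_of_real (2 * sinc (\<eta> \<bullet> snd p)))"
      unfolding U_def interval_fourier ..
    also have "\<dots> = (\<Prod>i<2 * m. \<Prod>b\<in>Basis. complex_of_real (2 * sinc (\<eta> \<bullet> b)))"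
      unfolding J_def by (subst prod.cartesian_product) (simp add: case_prod_beta)
    also have "\<dots> = complex_of_real (sinc_product m \<eta>)"
      by (simp add: sinc_product_def prod_power_distrib)
    finally show "(LINT \<omega>|M. 1 * cis (- (\<eta> \<bullet> Y \<omega>))) = complex_of_real (sinc_product m \<eta>)" .
  qed
qed

lemma gaussian_tail_tendsto:
  assumes g: "\<gamma> > 0"
  shows "(\<lambda>n. exp (- (\<gamma> * real (Suc n))\<^sup>2 / 2) * real (Suc n) ^ k) \<longlonglongrightarrow> 0"
proof (rule Lim_null_comparison)
  define a where "a = \<gamma>\<^sup>2 / 2"
  have a: "a > 0" using g by (simp add: a_def)
  have "filterlim (\<lambda>n. a * real (Suc n)) at_top sequentially"
    by (rule filterlim_tendsto_pos_mult_at_top[OF tendsto_const a])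
       (rule filterlim_compose[OF filterlim_real_sequentially filterlim_Suc])
  hence "(\<lambda>n. (a * real (Suc n)) ^ k / exp (a * real (Suc n))) \<longlonglongrightarrow> 0"
    by (rule filterlim_compose[OF tendsto_power_div_exp_0])
  from tendsto_mult_left[OF this, of "inverse (a ^ k)"]
  show "(\<lambda>n. inverse (a ^ k) * ((a * real (Suc n)) ^ k / exp (a * real (Suc n)))) \<longlonglongrightarrow> 0" by simp
  show "\<forall>\<^sub>F n in sequentially. norm (exp (- (\<gamma> * real (Suc n))\<^sup>2 / 2) * real (Suc n) ^ k)
      \<le> inverse (a ^ k) * ((a * real (Suc n)) ^ k / exp (a * real (Suc n)))"
  proof (intro always_eventually allI)
    fix n
    have "1 * real (Suc n) \<le> real (Suc n) * real (Suc n)" by (intro mult_right_mono) auto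
    hence "a * real (Suc n) \<le> a * (real (Suc n) * real (Suc n))" using a by (intro mult_left_mono) auto
    also have "\<dots> = (\<gamma> * real (Suc n))\<^sup>2 / 2" by (simp add: a_def power2_eq_square)
    finally have "exp (- (\<gamma> * real (Suc n))\<^sup>2 / 2) \<le> exp (- (a * real (Suc n)))" by simp
    hence "exp (- (\<gamma> * real (Suc n))\<^sup>2 / 2) * real (Suc n) ^ k \<le> exp (- (a * real (Suc n))) * real (Suc n) ^ k"
      by (intro mult_right_mono) auto
    also have "\<dots> = inverse (a ^ k) * ((a * real (Suc n)) ^ k / exp (a * real (Suc n)))"
      using a by (simp add: power_mult_distrib exp_minus divide_inverse)
    finally show "norm (exp (- (\<gamma> * real (Suc n))\<^sup>2 / 2) * real (Suc n) ^ k)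
      \<le> inverse (a ^ k) * ((a * real (Suc n)) ^ k / exp (a * real (Suc n)))" by (simp add: abs_mult)
  qed
qed

lemma gaussian_scaled_mono:
  fixes \<gamma> d k N :: real
  assumes "0 \<le> \<gamma>" "\<gamma> \<le> d" "0 \<le> k" "0 \<le> N"
  shows "N * exp (- (d / inverse k)\<^sup>2 / 2) / inverse k ^ D \<le> N * (exp (- (\<gamma> * k)\<^sup>2 / 2) * k ^ D)"
proof -
  have "(\<gamma> * k)\<^sup>2 \<le> (d * k)\<^sup>2"
    using assms by (intro power_mono mult_right_mono) auto
  hence "N * (exp (- (d * k)\<^sup>2 / 2) * k ^ D) \<le> N * (exp (- (\<gamma> * k)\<^sup>2 / 2) * k ^ D)"
    using assms by (intro mult_left_mono mult_right_mono) auto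
  thus ?thesis by (simp only: divide_inverse power_inverse inverse_inverse_eq mult.assoc)
qed

lemma gaussian_mean_far_bound:
  fixes y :: "'a::euclidean_space" and k N \<gamma> :: real
  assumes M: "integrable M (\<lambda>_. 1 :: complex)"
    and far: "\<And>\<omega>. \<omega> \<in> space M \<Longrightarrow> \<gamma> \<le> norm (y - Y \<omega>)"
    and "0 \<le> \<gamma>" "0 \<le> k" "0 \<le> N"
  shows "norm (LINT \<omega>|M. 1 * complex_of_real (N * exp (- (norm (y - Y \<omega>) / inverse k)\<^sup>2 / 2) / inverse k ^ D))
    \<le> measure M (space M) * N * (exp (- (\<gamma> * k)\<^sup>2 / 2) * k ^ D)"
proof -
  define B where "B = N * (exp (- (\<gamma> * k)\<^sup>2 / 2) * k ^ D)"
  define G where "G \<omega> = N * exp (- (norm (y - Y \<omega>) / inverse k)\<^sup>2 / 2) / inverse k ^ D" for \<omega>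
  have "norm (LINT \<omega>|M. 1 * complex_of_real (G \<omega>)) \<le> (LINT \<omega>|M. norm (1 * complex_of_real (G \<omega>)))"
    by (rule integral_norm_bound)
  also have "\<dots> \<le> (LINT \<omega>|M. B)"
  proof (rule integral_mono')
    have "integrable M (\<lambda>_. norm (1 :: complex) * B)"
      by (rule integrable_mult_left) (rule integrable_norm[OF M])
    thus "integrable M (\<lambda>_. B)" by simp
    show "0 \<le> B" using assms by (simp add: B_def)
    fix \<omega> assume w: "\<omega> \<in> space M"
    have "G \<omega> \<le> B"
      unfolding G_def B_def using assms far[OF w] by (intro gaussian_scaled_mono)
    moreover have "0 \<le> G \<omega>" unfolding G_def using assms by simp
    ultimately show "norm (1 * complex_of_real (G \<omega>)) \<le> B" by simp
  qed
  also have "\<dots> = measure M (space M) * N * (exp (- (\<gamma> * k)\<^sup>2 / 2) * k ^ D)"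
    by (simp add: B_def)
  finally show ?thesis unfolding G_def .
qed

text \<open>
  The integral is the spline at the point \<open>y\<close>, which lies outside its support: the Gaussian means
  of a measure vanish in the limit at points away from the support of the measure.
\<close>
lemma sinc_product_integral_zero:
  fixes y :: "'a::euclidean_space"
  assumes S: "integrable lborel (sinc_product m :: 'a \<Rightarrow> real)"
    and b: "b \<in> Basis" and far: "\<bar>y \<bullet> b\<bar> > 2 * real m"
  shows "(LINT \<eta>|lborel. complex_of_real (sinc_product m \<eta>) * cis (\<eta> \<bullet> y)) = 0"
proof -
  obtain M :: "(nat \<times> 'a \<Rightarrow> real) measure" and Y
    where *: "sigma_finite_measure M \<and> integrable M (\<lambda>_. 1 :: complex) \<and> Y \<in> borel_measurable M \<and>
    (\<forall>\<omega>\<in>space M. \<forall>b\<in>Basis. \<bar>Y \<omega> \<bullet> b\<bar> \<le> 2 * real m) \<and>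
    (\<forall>\<eta> :: 'a. (LINT \<omega>|M. 1 * cis (- (\<eta> \<bullet> Y \<omega>))) = complex_of_real (sinc_product m \<eta>))"
    using sinc_product_fourier[of m, where 'a = 'a] by (elim exE)
  from * have M: "sigma_finite_measure M" "integrable M (\<lambda>_. 1 :: complex)" "Y \<in> borel_measurable M"
    by - (elim conjE, assumption)+
  from * have M4: "\<bar>Y \<omega> \<bullet> b\<bar> \<le> 2 * real m" if "\<omega> \<in> space M" "b \<in> Basis" for \<omega> b
    using that by (elim conjE) (drule bspec, assumption, erule bspec)
  from * have M5: "(LINT \<omega>|M. 1 * cis (- (\<eta> \<bullet> Y \<omega>))) = complex_of_real (sinc_product m \<eta>)" for \<eta>
    by (elim conjE) (erule spec)
  have [measurable]: "(sinc_product m :: 'a \<Rightarrow> real) \<in> borel_measurable borel" using S by auto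
  let ?F = "\<lambda>\<eta>. complex_of_real (sinc_product m \<eta>) * cis (\<eta> \<bullet> y)"
  have F: "integrable lborel ?F"
    by (rule Bochner_Integration.integrable_bound[OF S]) (auto simp: norm_mult)
  define \<gamma> where "\<gamma> = \<bar>y \<bullet> b\<bar> - 2 * real m"
  have g: "\<gamma> > 0" using far by (simp add: \<gamma>_def)
  define V where "V = measure M (space M)"
  define N where "N = sqrt (2 * pi) ^ DIM('a)"
  define A where "A n = (LINT \<eta>|lborel. ?F \<eta> * complex_of_real (exp (- (inverse (real (Suc n)) * norm \<eta>)\<^sup>2 / 2)))" for n
  have "A \<longlonglongrightarrow> (LINT \<eta>|lborel. ?F \<eta>)"
    unfolding A_def by (rule gaussian_regularisation_tendsto[OF F])
  moreover have "A \<longlonglongrightarrow> 0"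
  proof (rule Lim_null_comparison)
    show "(\<lambda>n. V * N * (exp (- (\<gamma> * real (Suc n))\<^sup>2 / 2) * real (Suc n) ^ DIM('a))) \<longlonglongrightarrow> 0"
      using tendsto_mult_left[OF gaussian_tail_tendsto[OF g], of "V * N" "DIM('a)"] by simp
    show "\<forall>\<^sub>F n in sequentially. norm (A n) \<le> V * N * (exp (- (\<gamma> * real (Suc n))\<^sup>2 / 2) * real (Suc n) ^ DIM('a))"
    proof (intro always_eventually allI)
      fix n
      have An: "A n = (LINT \<omega>|M. 1 * complex_of_real
          (N * exp (- (norm (y - Y \<omega>) / inverse (real (Suc n)))\<^sup>2 / 2) / inverse (real (Suc n)) ^ DIM('a)))"
        unfolding A_def M5[symmetric] N_def
        by (rule gaussian_regularised_inversion[OF M(1,2,3)]) simp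
      show "norm (A n) \<le> V * N * (exp (- (\<gamma> * real (Suc n))\<^sup>2 / 2) * real (Suc n) ^ DIM('a))"
        unfolding An V_def
      proof (rule gaussian_mean_far_bound[OF M(2)])
        fix \<omega> assume w: "\<omega> \<in> space M"
        have "\<bar>y \<bullet> b - Y \<omega> \<bullet> b\<bar> \<le> norm (y - Y \<omega>)"
          using Basis_le_norm[OF b, of "y - Y \<omega>"] by (simp only: inner_diff_left)
        thus "\<gamma> \<le> norm (y - Y \<omega>)" using M4[OF w b] unfolding \<gamma>_def by linarith
      next
        show "0 \<le> \<gamma>" using g by simp
        show "0 \<le> real (Suc n)" by (rule of_nat_0_le_iff)
        show "0 \<le> N" unfolding N_def by (rule zero_le_power) (rule real_sqrt_ge_zero, rule mult_nonneg_nonneg, simp, rule pi_ge_zero)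
      qed
    qed
  qed
  ultimately show ?thesis by (rule LIMSEQ_unique)
qed

lemma sinc_sq_le: "(sinc s)\<^sup>2 \<le> 2 / (1 + s\<^sup>2)"
proof (cases "\<bar>s\<bar> \<le> 1")
  case True
  have "\<bar>sinc s\<bar> \<le> 1"
    using abs_sin_x_le_abs_x[of s] by (auto simp: abs_divide)
  hence "(sinc s)\<^sup>2 \<le> 1" by (simp add: abs_square_le_1)
  moreover have "s\<^sup>2 \<le> 1" using True by (simp add: abs_square_le_1)
  hence "1 \<le> 2 / (1 + s\<^sup>2)" using add_pos_nonneg[of 1 "s\<^sup>2"] by (simp add: le_divide_eq)
  ultimately show ?thesis by (rule order_trans)
next
  case False
  hence s: "s\<^sup>2 > 1" "s \<noteq> 0" by (auto simp: abs_square_less_1 not_le power2_eq_1_iff abs_le_square_iff[of 1 s, simplified] less_le)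
  have "(sinc s)\<^sup>2 = (sin s)\<^sup>2 / s\<^sup>2" using s by (simp add: power_divide)
  also have "\<dots> \<le> 1 / s\<^sup>2" using s by (intro divide_right_mono) (auto simp: abs_square_le_1)
  also have "\<dots> \<le> 2 / (1 + s\<^sup>2)" using s by (simp add: divide_simps)
  finally show ?thesis .
qed

lemma one_plus_sum_le_prod:
  fixes a :: "'i \<Rightarrow> real"
  assumes "finite A" "\<And>i. i \<in> A \<Longrightarrow> 0 \<le> a i"
  shows "1 + sum a A \<le> (\<Prod>i\<in>A. 1 + a i)"
  using assms
proof (induction A rule: finite_induct)
  case (insert i A)
  have s: "0 \<le> sum a A" and ai: "0 \<le> a i" using insert by (auto intro: sum_nonneg)
  have "1 + sum a (insert i A) \<le> (1 + a i) * (1 + sum a A)"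
    using insert s ai by (simp add: algebra_simps)
  also have "\<dots> \<le> (1 + a i) * (\<Prod>i\<in>A. 1 + a i)"
    using insert ai by (intro mult_left_mono) auto
  finally show ?case using insert by simp
qed simp

lemma sinc_product_nonneg: "0 \<le> sinc_product m \<eta>"
  unfolding sinc_product_def by (intro prod_nonneg ballI) (simp only: power_mult zero_le_power zero_le_power2)

text \<open>
  Each squared sinc function decays like \<open>1 / (1 + s\<^sup>2)\<close>, and the product of these one-dimensional
  weights is at most the radial one.
\<close>
lemma sinc_product_le:
  fixes \<eta> :: "'a::euclidean_space"
  shows "sinc_product m \<eta> \<le> 8 ^ (m * DIM('a)) / (1 + (norm \<eta>)\<^sup>2) ^ m"
proof -
  have p: "0 < 1 + (norm \<eta>)\<^sup>2" by (rule add_pos_nonneg) auto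
  have "(2 * sinc (\<eta> \<bullet> b)) ^ (2 * m) \<le> (8 / (1 + (\<eta> \<bullet> b)\<^sup>2)) ^ m" for b
    unfolding power_mult
  proof (rule power_mono)
    show "(2 * sinc (\<eta> \<bullet> b))\<^sup>2 \<le> 8 / (1 + (\<eta> \<bullet> b)\<^sup>2)"
    proof -
      have "x \<le> 2 / y \<Longrightarrow> 2\<^sup>2 * x \<le> 8 / y" for x y :: real
        unfolding power2_eq_square by linarith
      from this[OF sinc_sq_le[of "\<eta> \<bullet> b"]] show ?thesis by (simp only: power_mult_distrib)
    qed
  qed (rule zero_le_power2)
  hence "sinc_product m \<eta> \<le> (\<Prod>b\<in>Basis. (8 / (1 + (\<eta> \<bullet> b)\<^sup>2)) ^ m)"
    unfolding sinc_product_def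
    by (intro prod_mono conjI) (simp_all only: power_mult zero_le_power zero_le_power2)
  also have "\<dots> = 8 ^ (m * DIM('a)) / (\<Prod>b\<in>Basis. 1 + (\<eta> \<bullet> b)\<^sup>2) ^ m"
    by (simp add: prod_power_distrib[symmetric] prod_dividef power_divide power_mult mult.commute)
  also have "\<dots> \<le> 8 ^ (m * DIM('a)) / (1 + (norm \<eta>)\<^sup>2) ^ m"
  proof (rule divide_left_mono)
    have "1 + (norm \<eta>)\<^sup>2 \<le> (\<Prod>b\<in>Basis. 1 + (\<eta> \<bullet> b)\<^sup>2)"
      unfolding norm_sq_eq_sum_Basis by (rule one_plus_sum_le_prod) auto
    thus "(1 + (norm \<eta>)\<^sup>2) ^ m \<le> (\<Prod>b\<in>Basis. 1 + (\<eta> \<bullet> b)\<^sup>2) ^ m"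
      using p by (intro power_mono) auto
    show "0 < (\<Prod>b\<in>Basis. 1 + (\<eta> \<bullet> b)\<^sup>2) ^ m * (1 + (norm \<eta>)\<^sup>2) ^ m"
      using p by (intro mult_pos_pos zero_less_power prod_pos ballI add_pos_nonneg) auto
  qed simp
  finally show ?thesis .
qed

lemma sinc_product_continuous: "continuous_on UNIV (sinc_product m :: 'a::euclidean_space \<Rightarrow> real)"
proof -
  have c: "continuous_on UNIV (\<lambda>\<eta>::'a. sinc (\<eta> \<bullet> b))" for b
    by (rule continuous_on_sinc) (intro continuous_intros)
  show ?thesis unfolding sinc_product_def
    by (intro continuous_on_prod continuous_on_power continuous_on_mult continuous_on_const c)
qed

lemma sinc_product_integral_pos:
  assumes S: "integrable lborel (sinc_product m :: 'a::euclidean_space \<Rightarrow> real)"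
  shows "0 < (LINT \<eta>|lborel. sinc_product m (\<eta> :: 'a))"
proof -
  have z: "sinc_product m (0 :: 'a) = 4 ^ (m * DIM('a))"
    by (simp add: sinc_product_def power_mult)
  have "open (sinc_product m -` {1/2<..} :: 'a set)"
    using continuous_on_open_vimage[OF open_UNIV] sinc_product_continuous by (metis open_greaterThan inf_top.right_neutral)
  moreover have "(0::'a) \<in> sinc_product m -` {1/2<..}"
  proof -
    have "1 \<le> (4::real) ^ (m * DIM('a))" by (rule one_le_power) simp
    thus ?thesis unfolding vimage_eq greaterThan_iff z by linarith
  qed
  ultimately obtain e where e: "e > 0" "ball (0::'a) e \<subseteq> sinc_product m -` {1/2<..}"
    by (meson open_contains_ball)
  have "0 < measure lborel (ball (0::'a) e)" using content_ball_pos[OF e(1)] .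
  hence "0 < (1/2) * measure lborel (ball (0::'a) e)" by simp
  also have "\<dots> = (LINT \<eta>|lborel. (1/2) * indicator (ball (0::'a) e) \<eta>)" by simp
  also have "\<dots> \<le> (LINT \<eta>|lborel. sinc_product m (\<eta> :: 'a))"
  proof (rule integral_mono'[OF S])
    fix \<eta> :: 'a
    show "(1/2) * indicator (ball (0::'a) e) \<eta> \<le> sinc_product m \<eta>"
      using e(2) sinc_product_nonneg[of m \<eta>] by (auto simp: indicator_def)
    show "0 \<le> sinc_product m \<eta>" by (rule sinc_product_nonneg)
  qed
  finally show ?thesis .
qed

section \<open>Coercivity of the kernel matrix\<close>

context sobolev_kernel
begin

lemma sinc_product_le_bessel_weight:
  assumes m: "r \<le> real m"
  shows "sinc_product m \<eta> \<le> 8 ^ (m * DIM('a)) * bessel_weight \<eta>"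
proof -
  have p: "1 \<le> 1 + (norm \<eta>)\<^sup>2" by simp
  have "1 / (1 + (norm \<eta>)\<^sup>2) ^ m = (1 + (norm \<eta>)\<^sup>2) powr (- real m)"
    using p by (simp add: powr_minus powr_realpow divide_inverse add_pos_nonneg)
  also have "\<dots> \<le> bessel_weight \<eta>" unfolding bessel_weight_def using m p by (intro powr_mono) auto
  finally have "8 ^ (m * DIM('a)) * (1 / (1 + (norm \<eta>)\<^sup>2) ^ m) \<le> 8 ^ (m * DIM('a)) * bessel_weight \<eta>"
    by (intro mult_left_mono) auto
  thus ?thesis using sinc_product_le[of m \<eta>] by simp
qed

lemma sinc_product_integrable:
  assumes m: "r \<le> real m"
  shows "integrable lborel (sinc_product m :: 'a \<Rightarrow> real)"
proof (rule Bochner_Integration.integrable_bound)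
  show "integrable lborel (\<lambda>\<eta>. 8 ^ (m * DIM('a)) * bessel_weight \<eta>)"
    using bessel_weight_integrable by simp
  show "(sinc_product m :: 'a \<Rightarrow> real) \<in> borel_measurable lborel"
    using borel_measurable_continuous_onI[OF sinc_product_continuous] by simp
  show "AE \<eta> in lborel. norm (sinc_product m \<eta>) \<le> norm (8 ^ (m * DIM('a)) * bessel_weight \<eta>)"
    unfolding real_norm_def abs_of_nonneg[OF sinc_product_nonneg]
    by (intro AE_I2 order_trans[OF sinc_product_le_bessel_weight[OF m] abs_ge_self])
qed

lemma bessel_weight_scale:
  assumes "0 < \<delta>" "\<delta> \<le> 1"
  shows "bessel_weight (\<delta> *\<^sub>R \<xi>) \<le> \<delta> powr (- 2 * r) * bessel_weight \<xi>"
proof -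
  have p: "1 + (norm \<xi>)\<^sup>2 > 0" by (rule add_pos_nonneg) auto
  have "\<delta>\<^sup>2 * (1 + (norm \<xi>)\<^sup>2) \<le> 1 + (norm (\<delta> *\<^sub>R \<xi>))\<^sup>2"
    using assms by (simp add: power_mult_distrib distrib_left power_le_one)
  hence "(1 + (norm (\<delta> *\<^sub>R \<xi>))\<^sup>2) powr (- r) \<le> (\<delta>\<^sup>2 * (1 + (norm \<xi>)\<^sup>2)) powr (- r)"
  proof (rule powr_mono2'[rotated 2])
    show "- r \<le> 0" using r_pos by simp
    show "0 < \<delta>\<^sup>2 * (1 + (norm \<xi>)\<^sup>2)" using assms p by simp
  qed
  also have "\<dots> = (\<delta>\<^sup>2) powr (- r) * (1 + (norm \<xi>)\<^sup>2) powr (- r)"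
    by (rule powr_mult)
  also have "(\<delta>\<^sup>2) powr (- r) = \<delta> powr (- 2 * r)"
    using assms powr_powr[of \<delta> 2 "- r"] by (simp add: powr_numeral)
  finally show ?thesis by (simp add: bessel_weight_def)
qed

text \<open>
  The smallest eigenvalue of the kernel matrix. Rescale the spline so that its support is smaller
  than the distance between nodes. Its spectrum \<open>S (\<delta>\<xi>)\<close> is at most a constant times \<open>\<delta>\<^bsup>-2r\<^esup>\<close> times
  the spectrum of the kernel, while its quadratic form is exactly diagonal with entries proportional to \<open>\<delta>\<^bsup>-d\<^esup>\<close>.
\<close>
lemma kernel_matrix_coercive:
  "\<exists>lo>0. \<forall>(I :: nat set) y c q. finite I \<longrightarrow> 0 < q \<longrightarrow> q \<le> 1 \<longrightarrow>
     (\<forall>i\<in>I. \<forall>j\<in>I. i \<noteq> j \<longrightarrow> 2 * q \<le> norm (y i - y j)) \<longrightarrow>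
     lo * q powr (2 * r - DIM('a)) * (\<Sum>i\<in>I. (c i)\<^sup>2) \<le> (\<Sum>i\<in>I. \<Sum>j\<in>I. c i * c j * \<Phi> (y i - y j))"
proof -
  define m where "m = nat \<lceil>r\<rceil>"
  have m: "r \<le> real m" "m > 0" using r_pos by (auto simp: m_def real_nat_ceiling_ge)
  define S where "S = (sinc_product m :: 'a \<Rightarrow> real)"
  have S: "integrable lborel S" unfolding S_def by (rule sinc_product_integrable[OF m(1)])
  define J where "J = (LINT \<eta>|lborel. S \<eta>)"
  have J: "J > 0" unfolding J_def S_def by (rule sinc_product_integral_pos[OF S[unfolded S_def]])
  define D where "D = real DIM('a)"
  have D: "D \<ge> 1" by (simp add: D_def Suc_leI)
  define N :: real where "N = 8 ^ (m * DIM('a))"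
  have N: "N > 0" by (simp add: N_def)
  define s where "s = 2 * real m * D"
  have s: "s \<ge> 1"
    using D m(2) mult_mono[of 1 "2 * real m" 1 D] by (simp add: s_def)
  define lo where "lo = \<kappa> * c1 * J / (N * s powr (2 * r - D))"
  show ?thesis
  proof (intro exI[of _ lo] conjI allI impI)
    show "lo > 0" unfolding lo_def using \<kappa>_pos c1 J N s by (intro divide_pos_pos mult_pos_pos) auto
    fix I :: "nat set" and y :: "nat \<Rightarrow> 'a" and c :: "nat \<Rightarrow> real" and q :: real
    assume I: "finite I" and q: "0 < q" "q \<le> 1"
      and sep: "\<forall>i\<in>I. \<forall>j\<in>I. i \<noteq> j \<longrightarrow> 2 * q \<le> norm (y i - y j)"
    \<comment> \<open>The rescaled spline has support of half-width 2 m \<delta> = q / d, whereas two nodes differ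
      by at least 2 q / d in some coordinate.\<close>
    define \<delta> where "\<delta> = q / s"
    have \<delta>: "0 < \<delta>" "\<delta> \<le> 1" using q s by (auto simp: \<delta>_def divide_le_eq)
    have d0: "\<delta> \<noteq> 0" using \<delta> by simp
    define w where "w \<xi> = S (0 + \<delta> *\<^sub>R \<xi>)" for \<xi>
    have w: "integrable lborel w" unfolding w_def by (rule lborel_integral_scale(1)[OF S d0])
    define A where "A \<xi> = (cmod (\<Sum>i\<in>I. complex_of_real (c i) * cis (\<xi> \<bullet> y i)))\<^sup>2" for \<xi>
    have Si: "integrable lborel (\<lambda>\<eta>. complex_of_real (S \<eta>) * cis (\<eta> \<bullet> z))" for z
      by (rule Bochner_Integration.integrable_bound[OF S])
         (use S in \<open>auto simp: norm_mult\<close>)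
    have wz: "(LINT \<xi>|lborel. complex_of_real (w \<xi>) * cis (\<xi> \<bullet> z))
        = (1 / \<delta> ^ DIM('a)) *\<^sub>R (LINT \<eta>|lborel. complex_of_real (S \<eta>) * cis (\<eta> \<bullet> (z /\<^sub>R \<delta>)))" for z
    proof -
      have "complex_of_real (w \<xi>) * cis (\<xi> \<bullet> z)
          = (\<lambda>\<eta>. complex_of_real (S \<eta>) * cis (\<eta> \<bullet> (z /\<^sub>R \<delta>))) (0 + \<delta> *\<^sub>R \<xi>)" for \<xi>
      proof -
        have "(0 + \<delta> *\<^sub>R \<xi>) \<bullet> (z /\<^sub>R \<delta>) = \<xi> \<bullet> z" using d0 by simp
        thus ?thesis by (simp only: w_def)
      qed
      thus ?thesis using lborel_integral_scale(2)[OF Si d0, of 0 "z /\<^sub>R \<delta>"] \<delta> by simp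
    qed
    have off: "(LINT \<xi>|lborel. complex_of_real (w \<xi>) * cis (\<xi> \<bullet> (y i - y j))) = 0"
      if ij: "i \<in> I" "j \<in> I" "i \<noteq> j" for i j
    proof -
      have "\<exists>b\<in>Basis. 2 * q / D \<le> \<bar>(y i - y j) \<bullet> b\<bar>"
      proof (rule ccontr)
        assume "\<not> ?thesis"
        hence "\<And>b. b \<in> Basis \<Longrightarrow> \<bar>(y i - y j) \<bullet> b\<bar> < 2 * q / D" by (auto simp: not_le)
        hence "(\<Sum>b\<in>Basis. \<bar>(y i - y j) \<bullet> b\<bar>) < (\<Sum>b\<in>(Basis::'a set). 2 * q / D)"
          by (intro sum_strict_mono) auto
        also have "\<dots> = 2 * q" using D by (simp add: D_def)
        finally show False using norm_le_l1[of "y i - y j"] sep ij by fastforce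
      qed
      then obtain b where b: "b \<in> Basis" "2 * q / D \<le> \<bar>(y i - y j) \<bullet> b\<bar>" by blast
      have "2 * real m < 4 * real m" using m by simp
      also have "4 * real m = inverse \<delta> * (2 * q / D)"
        using q D by (simp add: \<delta>_def s_def field_simps)
      also have "\<dots> \<le> inverse \<delta> * \<bar>(y i - y j) \<bullet> b\<bar>"
        using b \<delta> by (intro mult_left_mono) auto
      also have "\<dots> = \<bar>((y i - y j) /\<^sub>R \<delta>) \<bullet> b\<bar>" using \<delta> by (simp add: abs_mult)
      finally have "2 * real m < \<bar>((y i - y j) /\<^sub>R \<delta>) \<bullet> b\<bar>" .
      from sinc_product_integral_zero[OF S[unfolded S_def] b(1) this]
      show ?thesis unfolding wz S_def by simp
    qed
    have diag: "(LINT \<xi>|lborel. complex_of_real (w \<xi>) * cis (\<xi> \<bullet> (y i - y i))) = complex_of_real (J / \<delta> ^ DIM('a))" for i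
      unfolding wz by (simp add: J_def scaleR_conv_of_real)
    have "complex_of_real (LINT \<xi>|lborel. w \<xi> * A \<xi>)
        = (\<Sum>i\<in>I. \<Sum>j\<in>I. complex_of_real (c i * c j)
          * (LINT \<xi>|lborel. complex_of_real (w \<xi>) * cis (\<xi> \<bullet> (y i - y j))))"
      unfolding A_def by (rule quadratic_form_integral(2)[OF w I])
    also have "\<dots> = (\<Sum>i\<in>I. \<Sum>j\<in>I. if j = i then complex_of_real ((c i)\<^sup>2 * (J / \<delta> ^ DIM('a))) else 0)"
      by (intro sum.cong refl) (use off in \<open>auto simp: diag[simplified] power2_eq_square\<close>)
    also have "\<dots> = complex_of_real ((\<Sum>i\<in>I. (c i)\<^sup>2) * (J / \<delta> ^ DIM('a)))"
      using I by (simp add: sum_distrib_right sum_divide_distrib)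
    finally have val: "(LINT \<xi>|lborel. w \<xi> * A \<xi>) = (\<Sum>i\<in>I. (c i)\<^sup>2) * (J / \<delta> ^ DIM('a))"
      by (simp only: of_real_eq_iff)
    have A0: "0 \<le> A \<xi>" for \<xi> by (simp add: A_def)
    \<comment> \<open>Spectral comparison of the spline with the kernel.\<close>
    have le: "w \<xi> * A \<xi> \<le> (N * \<delta> powr (- 2 * r) / c1) * (\<rho> \<xi> * A \<xi>)" for \<xi>
    proof -
      have "w \<xi> \<le> N * bessel_weight (\<delta> *\<^sub>R \<xi>)"
        using sinc_product_le_bessel_weight[OF m(1), of "\<delta> *\<^sub>R \<xi>"] by (simp add: w_def S_def N_def)
      also have "\<dots> \<le> N * (\<delta> powr (- 2 * r) * bessel_weight \<xi>)"
        using bessel_weight_scale[OF \<delta>, of \<xi>] N by (intro mult_left_mono) auto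
      also have "\<dots> \<le> N * (\<delta> powr (- 2 * r) * (\<rho> \<xi> / c1))"
        using \<rho>_bounds(1)[of \<xi>] c1 N by (intro mult_left_mono) (auto simp: field_simps)
      finally have "w \<xi> * A \<xi> \<le> N * (\<delta> powr (- 2 * r) * (\<rho> \<xi> / c1)) * A \<xi>"
        using A0 by (rule mult_right_mono)
      thus ?thesis by (simp add: mult_ac)
    qed
    define QF where "QF = (\<Sum>i\<in>I. \<Sum>j\<in>I. c i * c j * \<Phi> (y i - y j))"
    have "(\<Sum>i\<in>I. (c i)\<^sup>2) * (J / \<delta> ^ DIM('a)) \<le> (LINT \<xi>|lborel. (N * \<delta> powr (- 2 * r) / c1) * (\<rho> \<xi> * A \<xi>))"
      unfolding val[symmetric]
    proof (rule integral_mono)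
      show "integrable lborel (\<lambda>\<xi>. w \<xi> * A \<xi>)" unfolding A_def by (rule quadratic_form_integral(1)[OF w I])
      show "integrable lborel (\<lambda>\<xi>. (N * \<delta> powr (- 2 * r) / c1) * (\<rho> \<xi> * A \<xi>))"
        unfolding A_def by (intro integrable_mult_right quadratic_form_fourier(1)[OF I])
    qed (rule le)
    also have "\<dots> = (N * \<delta> powr (- 2 * r) / c1) * (QF / \<kappa>)"
      using quadratic_form_fourier(2)[OF I, of c y] \<kappa>_pos unfolding QF_def A_def by simp
    finally have 1: "(\<Sum>i\<in>I. (c i)\<^sup>2) * (J / \<delta> ^ DIM('a)) \<le> (N * \<delta> powr (- 2 * r) / c1) * (QF / \<kappa>)" .
    have e1: "\<delta> ^ DIM('a) = \<delta> powr D" using \<delta> by (simp add: D_def powr_realpow)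
    have e2: "\<delta> powr (- 2 * r) = 1 / (\<delta> powr (2 * r - D) * \<delta> powr D)"
      using \<delta> by (simp add: powr_add[symmetric] powr_minus_divide[symmetric])
    define X where "X = \<delta> powr (2 * r - D)"
    define Z where "Z = \<delta> powr D"
    have XZ: "X > 0" "Z > 0" using \<delta> by (auto simp: X_def Z_def)
    have "(\<Sum>i\<in>I. (c i)\<^sup>2) * (J / Z) \<le> (N * (1 / (X * Z)) / c1) * (QF / \<kappa>)"
      using 1 unfolding e1 e2 X_def Z_def .
    hence "(\<kappa> * c1 * J / N) * X * (\<Sum>i\<in>I. (c i)\<^sup>2) \<le> QF"
      using XZ N c1 \<kappa>_pos by (simp add: field_simps)
    moreover have "X = q powr (2 * r - D) / s powr (2 * r - D)"
      unfolding X_def \<delta>_def by (rule powr_divide)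
    ultimately show "lo * q powr (2 * r - DIM('a)) * (\<Sum>i\<in>I. (c i)\<^sup>2) \<le> (\<Sum>i\<in>I. \<Sum>j\<in>I. c i * c j * \<Phi> (y i - y j))"
      by (simp add: lo_def QF_def D_def)
  qed
qed

end

section \<open>Polynomials in a shift operator\<close>

definition coeff_norm :: "real poly \<Rightarrow> real" where
  "coeff_norm p = (\<Sum>i\<le>degree p. \<bar>poly.coeff p i\<bar>)"

lemma coeff_norm_eq: "degree p \<le> n \<Longrightarrow> coeff_norm p = (\<Sum>i\<le>n. \<bar>poly.coeff p i\<bar>)"
  unfolding coeff_norm_def by (rule sum.mono_neutral_left) (auto simp: coeff_eq_0)

lemma coeff_norm_nonneg: "0 \<le> coeff_norm p"
  by (simp add: coeff_norm_def sum_nonneg)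

lemma coeff_norm_add: "coeff_norm (p + q) \<le> coeff_norm p + coeff_norm q"
proof -
  let ?n = "max (degree p) (degree q)"
  have "coeff_norm (p + q) = (\<Sum>i\<le>?n. \<bar>poly.coeff (p + q) i\<bar>)"
    by (rule coeff_norm_eq) (rule degree_add_le_max)
  also have "\<dots> \<le> (\<Sum>i\<le>?n. \<bar>poly.coeff p i\<bar> + \<bar>poly.coeff q i\<bar>)"
    by (intro sum_mono) simp
  also have "\<dots> = coeff_norm p + coeff_norm q"
    by (simp add: sum.distrib coeff_norm_eq[of p ?n] coeff_norm_eq[of q ?n])
  finally show ?thesis .
qed

lemma coeff_norm_smult: "coeff_norm (Polynomial.smult a p) = \<bar>a\<bar> * coeff_norm p"
  using coeff_norm_eq[of "Polynomial.smult a p" "degree p"]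
  by (simp add: degree_smult_le coeff_norm_def abs_mult sum_distrib_left)

lemma coeff_norm_pCons: "coeff_norm (pCons a p) = \<bar>a\<bar> + coeff_norm p"
proof -
  have "coeff_norm (pCons a p) = (\<Sum>i\<le>Suc (degree p). \<bar>poly.coeff (pCons a p) i\<bar>)"
    by (rule coeff_norm_eq) (rule degree_pCons_le)
  thus ?thesis by (simp only: sum.atMost_Suc_shift) (simp add: coeff_norm_def)
qed

lemma coeff_norm_0 [simp]: "coeff_norm 0 = 0"
  by (simp add: coeff_norm_def)

lemma coeff_norm_1 [simp]: "coeff_norm 1 = 1"
  using coeff_norm_pCons[of 1 0] by (simp add: one_pCons)

lemma coeff_norm_mult: "coeff_norm (p * q) \<le> coeff_norm p * coeff_norm q"
proof (induction p)
  case (pCons a p)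
  have "coeff_norm (pCons a p * q) \<le> coeff_norm (Polynomial.smult a q) + coeff_norm (pCons 0 (p * q))"
    unfolding mult_pCons_left by (rule coeff_norm_add)
  also have "\<dots> \<le> \<bar>a\<bar> * coeff_norm q + coeff_norm p * coeff_norm q"
    using pCons.IH by (simp add: coeff_norm_smult coeff_norm_pCons)
  finally show ?case by (simp add: coeff_norm_pCons distrib_right)
qed simp

lemma coeff_norm_power: "coeff_norm (p ^ n) \<le> coeff_norm p ^ n"
proof (induction n)
  case (Suc n)
  have "coeff_norm (p * p ^ n) \<le> coeff_norm p * coeff_norm (p ^ n)" by (rule coeff_norm_mult)
  also have "\<dots> \<le> coeff_norm p * coeff_norm p ^ n"
    using Suc coeff_norm_nonneg by (rule mult_left_mono)
  finally show ?case by simp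
qed simp

lemma poly_le_coeff_norm:
  fixes z :: complex
  assumes z: "cmod z \<le> 1"
  shows "cmod (poly (map_poly complex_of_real p) z) \<le> coeff_norm p"
proof (induction p)
  case (pCons a p)
  have e: "poly (map_poly complex_of_real (pCons a p)) z
      = complex_of_real a + z * poly (map_poly complex_of_real p) z"
    by (simp add: map_poly_pCons)
  have "cmod (z * poly (map_poly complex_of_real p) z) \<le> 1 * coeff_norm p"
    unfolding norm_mult using z pCons.IH by (intro mult_mono) auto
  thus ?case unfolding e coeff_norm_pCons
    using norm_triangle_ineq[of "complex_of_real a" "z * poly (map_poly complex_of_real p) z"] by simp
qed simp

lemma map_poly_of_real_mult:
  "map_poly complex_of_real (p * q) = map_poly complex_of_real p * map_poly complex_of_real q"
  by (rule poly_eqI) (simp add: coeff_map_poly coeff_mult)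

lemma map_poly_of_real_power:
  "map_poly complex_of_real (p ^ n) = map_poly complex_of_real p ^ n"
  by (induction n) (simp_all add: map_poly_of_real_mult)

definition diff_poly :: "real poly" where "diff_poly = [:-1, 1:]"

text \<open>
  Modulo \<open>D\<^sup>L\<close>, where \<open>D = X - 1\<close>, every positive power of \<open>D\<close> is congruent to a polynomial with
  small coefficients. The reason is that \<open>(X\<^sup>N - 1)/N\<close> has coefficient norm \<open>2/N\<close> and equals \<open>D E\<close>
  with \<open>E(1) = 1\<close>, so \<open>D\<^sup>k\<close> and \<open>(D E)\<^sup>k\<close> differ by a multiple of \<open>D\<^bsup>k+1\<^esup>\<close>. Downward induction on
  \<open>k\<close> disposes of that multiple. In analytic terms this is a Markov inequality: a function that is
  a polynomial up to small errors changes little over steps much shorter than its domain.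
\<close>
lemma diff_poly_power_small_remainder:
  assumes "k \<ge> 1" and "\<epsilon> > 0"
  shows "\<exists>R Q. diff_poly ^ k = R + diff_poly ^ L * Q \<and> coeff_norm R \<le> \<epsilon>"
  using assms
proof (induction "L - k" arbitrary: k \<epsilon>)
  case 0
  hence "diff_poly ^ k = 0 + diff_poly ^ L * diff_poly ^ (k - L)"
    by (simp add: power_add[symmetric])
  thus ?case using 0 coeff_norm_0 by (metis less_imp_le)
next
  case (Suc m)
  \<comment> \<open>The norm of (X^N - 1)/N is 2/N; the bound by 1 makes its k-th power at most its first.\<close>
  obtain N :: nat where N: "N > 0" "2 / real N \<le> min 1 (\<epsilon> / 2)"
  proof -
    define c where "c = min 1 (\<epsilon> / 2)"
    have p: "c > 0" using Suc.prems by (simp add: c_def)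
    obtain N :: nat where N: "real N > 2 / c" using reals_Archimedean2 by blast
    with p have "0 < real N" by (smt (verit) divide_pos_pos)
    moreover from this have "2 / real N \<le> c"
      using N p by (simp add: divide_less_eq divide_le_eq mult.commute)
    ultimately show ?thesis using that unfolding c_def by simp
  qed
  define X :: "real poly" where "X = [:0, 1:]"
  define E where "E = Polynomial.smult (1 / real N) (\<Sum>i<N. X ^ i)"
  have D: "diff_poly = X - 1" by (simp add: diff_poly_def X_def one_pCons)
  have DE: "diff_poly * E = Polynomial.smult (1 / real N) (X ^ N + Polynomial.smult (- 1) 1)"
  proof -
    have "(X - 1) * (\<Sum>i<N. X ^ i) = X ^ N - 1" by (rule power_diff_1_eq[symmetric])
    moreover have "X ^ N - 1 = X ^ N + Polynomial.smult (- 1) 1"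
      by (simp add: one_pCons del: pCons_one)
    ultimately show ?thesis unfolding E_def D mult_smult_right by (simp only:)
  qed
  have nX: "coeff_norm (X ^ N) \<le> 1"
    using coeff_norm_power[of X N] by (simp add: X_def coeff_norm_pCons)
  have "coeff_norm (X ^ N + Polynomial.smult (- 1) 1) \<le> 2"
    using coeff_norm_add[of "X ^ N" "Polynomial.smult (- 1) 1"] nX coeff_norm_smult[of "-1" 1] by simp
  hence nDE: "coeff_norm (diff_poly * E) \<le> 2 / real N"
    unfolding DE coeff_norm_smult using N by (simp add: divide_right_mono)
  have "poly (1 - E ^ k) 1 = 0"
    using N by (simp add: E_def X_def poly_sum)
  then obtain G where G: "1 - E ^ k = diff_poly * G"
    unfolding poly_eq_0_iff_dvd diff_poly_def by (auto simp: dvd_def)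
  define \<epsilon>' where "\<epsilon>' = \<epsilon> / (2 * (coeff_norm G + 1))"
  have Gp: "coeff_norm G + 1 > 0" using coeff_norm_nonneg[of G] by linarith
  have e': "\<epsilon>' > 0" using Suc.prems Gp by (simp add: \<epsilon>'_def)
  obtain R Q where RQ: "diff_poly ^ Suc k = R + diff_poly ^ L * Q" "coeff_norm R \<le> \<epsilon>'"
  proof -
    have "m = L - Suc k" using Suc.hyps(2) by simp
    from Suc.hyps(1)[OF this _ e'] show ?thesis using that by auto
  qed
  have "diff_poly ^ k = diff_poly ^ k * E ^ k + diff_poly ^ k * (1 - E ^ k)"
    by (simp add: algebra_simps)
  also have "\<dots> = (diff_poly * E) ^ k + diff_poly ^ Suc k * G"
    unfolding G by (simp add: power_mult_distrib mult_ac)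
  also have "\<dots> = ((diff_poly * E) ^ k + R * G) + diff_poly ^ L * (Q * G)"
    unfolding RQ(1) by (simp add: algebra_simps)
  finally have 1: "diff_poly ^ k = ((diff_poly * E) ^ k + R * G) + diff_poly ^ L * (Q * G)" .
  have "coeff_norm ((diff_poly * E) ^ k) \<le> coeff_norm (diff_poly * E) ^ k" by (rule coeff_norm_power)
  also have "\<dots> \<le> (2 / real N) ^ k" using nDE coeff_norm_nonneg by (rule power_mono)
  also have "\<dots> \<le> (2 / real N) ^ 1" using N Suc.prems by (intro power_decreasing) auto
  finally have 2: "coeff_norm ((diff_poly * E) ^ k) \<le> \<epsilon> / 2" using N by simp
  have "coeff_norm (R * G) \<le> coeff_norm R * coeff_norm G" by (rule coeff_norm_mult)
  also have "\<dots> \<le> \<epsilon>' * (coeff_norm G + 1)"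
    using RQ(2) coeff_norm_nonneg e' by (intro mult_mono) auto
  also have "\<dots> = \<epsilon> / 2" using Gp unfolding \<epsilon>'_def by (simp only: nonzero_eq_divide_eq) (simp add: field_simps)
  finally have "coeff_norm ((diff_poly * E) ^ k + R * G) \<le> \<epsilon>"
    using 2 coeff_norm_add[of "(diff_poly * E) ^ k" "R * G"] by simp
  with 1 show ?case by blast
qed

text \<open>The value at \<open>z\<close> of \<open>p(T) f\<close>, where \<open>T\<close> is the shift by \<open>w\<close>.\<close>
definition shift_comb :: "real poly \<Rightarrow> ('a::real_vector \<Rightarrow> real) \<Rightarrow> 'a \<Rightarrow> 'a \<Rightarrow> real" where
  "shift_comb p f z w = (\<Sum>j\<le>degree p. poly.coeff p j * f (z + real j *\<^sub>R w))"

lemma shift_comb_eq: "degree p \<le> n \<Longrightarrow> shift_comb p f z w = (\<Sum>j\<le>n. poly.coeff p j * f (z + real j *\<^sub>R w))"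
  unfolding shift_comb_def by (rule sum.mono_neutral_left) (auto simp: coeff_eq_0)

lemma shift_comb_add: "shift_comb (p + q) f z w = shift_comb p f z w + shift_comb q f z w"
proof -
  let ?n = "max (degree p) (degree q)"
  have "degree (p + q) \<le> ?n" by (rule degree_add_le_max)
  thus ?thesis
    by (simp add: shift_comb_eq[of p ?n] shift_comb_eq[of q ?n] shift_comb_eq[of "p + q" ?n]
        sum.distrib distrib_right)
qed

lemma shift_comb_diff_poly: "shift_comb diff_poly f z w = f (z + w) - f z"
  using shift_comb_eq[of diff_poly 1 f z w] by (simp add: diff_poly_def)

lemma shift_comb_bound:
  assumes "\<And>j. j \<le> degree p \<Longrightarrow> \<bar>f (z + real j *\<^sub>R w)\<bar> \<le> B"
  shows "\<bar>shift_comb p f z w\<bar> \<le> coeff_norm p * B"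
proof -
  have "\<bar>shift_comb p f z w\<bar> \<le> (\<Sum>j\<le>degree p. \<bar>poly.coeff p j\<bar> * B)"
    unfolding shift_comb_def using assms
    by (intro order_trans[OF sum_abs] sum_mono) (auto simp: abs_mult intro: mult_left_mono)
  thus ?thesis by (simp add: coeff_norm_def sum_distrib_right)
qed

section \<open>Difference functionals in the native space\<close>

context sobolev_kernel
begin

text \<open>
  The energy is the squared norm of the expansion in the native space of the kernel. Index sets
  instead of sets of nodes leave room for nodes that coincide.
\<close>
definition energy :: "'i set \<Rightarrow> ('i \<Rightarrow> real) \<Rightarrow> ('i \<Rightarrow> 'a) \<Rightarrow> real" where
  "energy I a x = (\<Sum>i\<in>I. \<Sum>j\<in>I. a i * a j * \<Phi> (x i - x j))"

definition expansion :: "'i set \<Rightarrow> ('i \<Rightarrow> real) \<Rightarrow> ('i \<Rightarrow> 'a) \<Rightarrow> 'a \<Rightarrow> real" where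
  "expansion I a x z = (\<Sum>i\<in>I. a i * \<Phi> (z - x i))"

lemma energy_fourier:
  assumes "finite I"
  shows "energy I a x = \<kappa> * (LINT \<xi>|lborel. \<rho> \<xi> * (cmod (\<Sum>i\<in>I. complex_of_real (a i) * cis (\<xi> \<bullet> x i)))\<^sup>2)"
  unfolding energy_def by (rule quadratic_form_fourier(2)[OF assms])

lemma energy_nonneg:
  assumes "finite I"
  shows "0 \<le> energy I a x"
  unfolding energy_fourier[OF assms]
  by (intro mult_nonneg_nonneg Bochner_Integration.integral_nonneg less_imp_le[OF \<kappa>_pos] \<rho>_nonneg zero_le_power2)

text \<open>
  The Cauchy-Schwarz inequality of the native space. The quadratic form of the kernel is
  nonnegative on the disjoint union of both families of nodes, and the left-hand side is its mixed
  term.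
\<close>
lemma expansion_functional_le:
  fixes a :: "'i \<Rightarrow> real" and b :: "'j \<Rightarrow> real"
  assumes I: "finite I" and J: "finite J"
  shows "(\<Sum>j\<in>J. b j * expansion I a x (y j))\<^sup>2 \<le> energy I a x * energy J b y"
proof -
  define B where "B = (\<Sum>j\<in>J. b j * expansion I a x (y j))"
  have B1: "B = (\<Sum>j\<in>J. \<Sum>i\<in>I. b j * a i * \<Phi> (y j - x i))"
    by (simp add: B_def expansion_def sum_distrib_left mult.assoc)
  have B2: "B = (\<Sum>i\<in>I. \<Sum>j\<in>J. a i * b j * \<Phi> (x i - y j))"
    unfolding B1 by (subst sum.swap) (intro sum.cong refl, metis \<Phi>_even minus_diff_eq mult.commute)
  \<comment> \<open>The binary form in s and t is nonnegative, so its discriminant is not positive.\<close>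
  have q: "0 \<le> s\<^sup>2 * energy I a x + 2 * s * t * B + t\<^sup>2 * energy J b y" for s t
  proof -
    define c where "c = case_sum (\<lambda>i. s * a i) (\<lambda>j. t * b j)"
    define z where "z = case_sum x y"
    have "0 \<le> energy (I <+> J) c z" using I J by (intro energy_nonneg) simp
    also have "energy (I <+> J) c z =
        (\<Sum>i\<in>I. (\<Sum>i'\<in>I. (s * a i) * (s * a i') * \<Phi> (x i - x i')) + (\<Sum>j\<in>J. (s * a i) * (t * b j) * \<Phi> (x i - y j)))
      + (\<Sum>j\<in>J. (\<Sum>i\<in>I. (t * b j) * (s * a i) * \<Phi> (y j - x i)) + (\<Sum>j'\<in>J. (t * b j) * (t * b j') * \<Phi> (y j - y j')))"
      unfolding energy_def using I J by (simp add: sum.Plus c_def z_def)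
    also have "\<dots> = s\<^sup>2 * energy I a x + s * t * B + (s * t * B + t\<^sup>2 * energy J b y)"
    proof -
      have 1: "(\<Sum>i\<in>I. \<Sum>i'\<in>I. (s * a i) * (s * a i') * \<Phi> (x i - x i')) = s\<^sup>2 * energy I a x"
        unfolding energy_def sum_distrib_left by (intro sum.cong refl) (simp only: power2_eq_square mult_ac)
      have 2: "(\<Sum>j\<in>J. \<Sum>j'\<in>J. (t * b j) * (t * b j') * \<Phi> (y j - y j')) = t\<^sup>2 * energy J b y"
        unfolding energy_def sum_distrib_left by (intro sum.cong refl) (simp only: power2_eq_square mult_ac)
      have 3: "(\<Sum>i\<in>I. \<Sum>j\<in>J. (s * a i) * (t * b j) * \<Phi> (x i - y j)) = s * t * B"
        unfolding B2 sum_distrib_left by (intro sum.cong refl) (simp only: mult_ac)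
      have 4: "(\<Sum>j\<in>J. \<Sum>i\<in>I. (t * b j) * (s * a i) * \<Phi> (y j - x i)) = s * t * B"
        unfolding B1 sum_distrib_left by (intro sum.cong refl) (simp only: mult_ac)
      show ?thesis unfolding sum.distrib 1 2 3 4 ..
    qed
    finally show ?thesis by (simp add: algebra_simps)
  qed
  define P where "P = energy I a x"
  define Q where "Q = energy J b y"
  have Q0: "Q \<ge> 0" unfolding Q_def by (rule energy_nonneg[OF J])
  have "B\<^sup>2 \<le> P * Q"
  proof (cases "Q = 0")
    case True
    have "B = 0"
    proof (rule ccontr)
      assume B: "B \<noteq> 0"
      \<comment> \<open>If Q = 0, the form is affine in t, and this value of t would make it equal to -1.\<close>
      have "0 \<le> P + 2 * (- (P + 1) / (2 * B)) * B"
        using q[of 1 "- (P + 1) / (2 * B)"] True by (simp add: P_def Q_def)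
      also have "2 * (- (P + 1) / (2 * B)) * B = - (P + 1)" using B by simp
      finally show False by simp
    qed
    thus ?thesis using True by simp
  next
    case False
    hence Q: "Q > 0" using Q0 by simp
    have "0 \<le> Q\<^sup>2 * P + 2 * Q * (- B) * B + (- B)\<^sup>2 * Q"
      using q[of Q "- B"] by (simp only: P_def Q_def)
    also have "\<dots> = Q * (P * Q - B\<^sup>2)" by (simp add: power2_eq_square algebra_simps)
    finally show ?thesis using Q by (simp add: zero_le_mult_iff)
  qed
  thus ?thesis by (simp only: B_def P_def Q_def)
qed

lemma expansion_bounded:
  "\<bar>expansion I a x z\<bar> \<le> (\<Sum>i\<in>I. \<bar>a i\<bar>) * \<Phi> 0"
  unfolding expansion_def sum_distrib_right
  by (rule order_trans[OF sum_abs], intro sum_mono) (auto simp: abs_mult intro!: mult_left_mono abs_\<Phi>_le)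

text \<open>
  A zero of order \<open>2L \<ge> 2r\<close> at frequency 0 compensates the singularity of \<open>s\<^bsup>-2r\<^esup>\<close>, so passing to
  the rescaled frequency \<open>u = hs\<close> gains the full factor \<open>h\<^bsup>2r\<^esup>\<close>.
\<close>
lemma spectral_weight_bound:
  fixes h s :: real
  assumes h: "0 < h" and s: "0 \<le> s" and L: "r \<le> real L"
  shows "(1 + s\<^sup>2) powr (- r) * min 2 (s * h) ^ (2 * L)
    \<le> 4 ^ L * 2 powr r * h powr (2 * r) * (1 + (h * s)\<^sup>2) powr (- r)"
proof -
  define u where "u = s * h"
  have u: "0 \<le> u" using s h by (simp add: u_def)
  \<comment> \<open>This v is at least u^2 for u at most 1 and at least 1 otherwise, which covers both ranges of
    the minimum without dividing by u.\<close>
  define v where "v = 2 * u\<^sup>2 / (1 + u\<^sup>2)"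
  have p: "0 < 1 + s\<^sup>2" "0 < 1 + u\<^sup>2" by (rule add_pos_nonneg, auto)+
  have v0: "0 \<le> v" using p by (simp add: v_def)
  have "min 2 u ^ (2 * L) \<le> 4 ^ L * v powr r"
  proof (cases "u \<le> 1")
    case True
    have "u\<^sup>2 \<le> v"
    proof -
      have "u\<^sup>2 * (1 + u\<^sup>2) \<le> u\<^sup>2 * 2" using True u by (intro mult_left_mono) (auto simp: power_le_one)
      thus ?thesis unfolding v_def using p by (simp add: le_divide_eq mult.commute)
    qed
    hence 1: "(u\<^sup>2) powr r \<le> v powr r" using r_pos by (intro powr_mono2) auto
    have "u ^ (2 * L) \<le> (u\<^sup>2) powr r"
    proof (cases "u = 0")
      case True
      have "L > 0" using L r_pos by (cases L) auto
      thus ?thesis using True by (simp add: zero_power)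
    next
      case False
      hence "u ^ (2 * L) = (u\<^sup>2) powr real L" using u by (simp add: power_mult powr_realpow)
      also have "\<dots> \<le> (u\<^sup>2) powr r" using False u True L by (intro powr_mono') (auto simp: power_le_one)
      finally show ?thesis .
    qed
    hence "u ^ (2 * L) \<le> 1 * v powr r" using 1 by simp
    also have "\<dots> \<le> 4 ^ L * v powr r" by (intro mult_right_mono one_le_power) auto
    finally show ?thesis using True by (simp add: min_absorb2)
  next
    case False
    have "1 \<le> u\<^sup>2" using False by simp
    hence "1 \<le> v" unfolding v_def using p by (simp add: le_divide_eq)
    hence v1: "1 \<le> v powr r" using r_pos by (intro ge_one_powr_ge_zero) auto
    have "min 2 u ^ (2 * L) \<le> 2 ^ (2 * L)" using u by (intro power_mono) auto
    also have "\<dots> = 4 ^ L * 1" by (simp add: power_mult)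
    also have "\<dots> \<le> 4 ^ L * v powr r" using v1 by (intro mult_left_mono) auto
    finally show ?thesis .
  qed
  hence "(1 + s\<^sup>2) powr (- r) * min 2 u ^ (2 * L) \<le> (1 + s\<^sup>2) powr (- r) * (4 ^ L * v powr r)"
    by (intro mult_left_mono) auto
  also have "\<dots> \<le> (1 + s\<^sup>2) powr (- r) * (4 ^ L * (2 powr r * h powr (2 * r) * (1 + s\<^sup>2) powr r * (1 + u\<^sup>2) powr (- r)))"
  proof (intro mult_left_mono)
    have "v powr r \<le> (2 * h\<^sup>2 * (1 + s\<^sup>2) / (1 + u\<^sup>2)) powr r"
      unfolding v_def u_def using r_pos h s
      by (intro powr_mono2 divide_right_mono) (auto simp: power_mult_distrib algebra_simps add_nonneg_nonneg)
    also have "\<dots> = 2 powr r * h powr (2 * r) * (1 + s\<^sup>2) powr r * (1 + u\<^sup>2) powr (- r)"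
    proof -
      have "(h\<^sup>2) powr r = h powr (2 * r)" using h powr_powr[of h 2 r] by (simp add: powr_numeral)
      thus ?thesis by (simp add: powr_mult powr_divide powr_minus_divide)
    qed
    finally show "v powr r \<le> 2 powr r * h powr (2 * r) * (1 + s\<^sup>2) powr r * (1 + u\<^sup>2) powr (- r)" .
  qed auto
  also have "\<dots> = ((1 + s\<^sup>2) powr (- r) * (1 + s\<^sup>2) powr r) * (4 ^ L * 2 powr r * h powr (2 * r) * (1 + u\<^sup>2) powr (- r))"
    by (simp only: mult_ac)
  also have "\<dots> = 4 ^ L * 2 powr r * h powr (2 * r) * (1 + u\<^sup>2) powr (- r)"
  proof -
    have "(1 + s\<^sup>2) powr (- r) * (1 + s\<^sup>2) powr r = 1" using p by (simp add: powr_add[symmetric])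
    thus ?thesis by (simp only: mult_1)
  qed
  finally show ?thesis by (simp only: u_def mult.commute)
qed

text \<open>
  In frequency space the functional \<open>(T - 1)\<^sup>L Q(T)\<close> is multiplication by
  \<open>(cis(\<xi>\<bullet>w) - 1)\<^sup>L Q(cis(\<xi>\<bullet>w))\<close>, whose first factor vanishes to order \<open>L\<close> at 0. After the
  substitution \<open>\<eta> = h\<xi>\<close> the Jacobian reduces \<open>h\<^bsup>2r\<^esup>\<close> to \<open>h\<^bsup>2r-d\<^esup>\<close>.
\<close>
lemma difference_energy_le:
  fixes Q :: "real poly"
  assumes L: "r \<le> real L"
  defines "p \<equiv> diff_poly ^ L * Q"
  shows "\<exists>C\<ge>0. \<forall>z w h. 0 < h \<longrightarrow> norm w \<le> h \<longrightarrow>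
     energy {..degree p} (poly.coeff p) (\<lambda>j. z + real j *\<^sub>R w) \<le> C * h powr (2 * r - DIM('a))"
proof -
  define N where "N = coeff_norm Q"
  have N: "N \<ge> 0" by (simp add: N_def coeff_norm_nonneg)
  define W where "W = (LINT \<xi>|lborel. bessel_weight \<xi>)"
  have W: "W \<ge> 0" unfolding W_def by (intro Bochner_Integration.integral_nonneg less_imp_le[OF bessel_weight_pos])
  define C0 where "C0 = c2 * (4 ^ L * 2 powr r) * N\<^sup>2"
  have C0: "C0 \<ge> 0" using c2 by (simp add: C0_def)
  show ?thesis
  proof (intro exI[of _ "\<kappa> * C0 * W"] conjI allI impI)
    show "0 \<le> \<kappa> * C0 * W" using \<kappa>_pos C0 W by simp
    fix z w :: 'a and h :: real assume h: "0 < h" and w: "norm w \<le> h"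
    define A where "A \<xi> = (\<Sum>j\<in>{..degree p}. complex_of_real (poly.coeff p j) * cis (\<xi> \<bullet> (z + real j *\<^sub>R w)))" for \<xi>
    have A: "A \<xi> = cis (\<xi> \<bullet> z) * ((cis (\<xi> \<bullet> w) - 1) ^ L * poly (map_poly complex_of_real Q) (cis (\<xi> \<bullet> w)))" for \<xi>
    proof -
      have "A \<xi> = cis (\<xi> \<bullet> z) * (\<Sum>j\<le>degree p. complex_of_real (poly.coeff p j) * cis (\<xi> \<bullet> w) ^ j)"
        unfolding A_def sum_distrib_left
        by (intro sum.cong refl) (simp add: inner_add_right cis_mult[symmetric] Complex.DeMoivre)
      also have "(\<Sum>j\<le>degree p. complex_of_real (poly.coeff p j) * cis (\<xi> \<bullet> w) ^ j)
          = poly (map_poly complex_of_real p) (cis (\<xi> \<bullet> w))"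
        by (simp add: poly_altdef coeff_map_poly degree_map_poly)
      also have "map_poly complex_of_real p = [:-1, 1:] ^ L * map_poly complex_of_real Q"
        unfolding p_def diff_poly_def map_poly_of_real_mult map_poly_of_real_power
        by (simp add: map_poly_pCons)
      also have "poly \<dots> (cis (\<xi> \<bullet> w)) = (cis (\<xi> \<bullet> w) - 1) ^ L * poly (map_poly complex_of_real Q) (cis (\<xi> \<bullet> w))"
        by simp
      finally show ?thesis .
    qed
    have Ab: "(cmod (A \<xi>))\<^sup>2 \<le> min 2 (norm \<xi> * h) ^ (2 * L) * N\<^sup>2" for \<xi>
    proof -
      have "\<bar>\<xi> \<bullet> w\<bar> \<le> norm \<xi> * h"
        using Cauchy_Schwarz_ineq2[of \<xi> w] mult_left_mono[OF w norm_ge_zero[of \<xi>]] by linarith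
      hence "cmod (cis (\<xi> \<bullet> w) - 1) \<le> min 2 (norm \<xi> * h)"
        using cmod_cis_minus_one[of "\<xi> \<bullet> w"] by linarith
      hence "cmod (cis (\<xi> \<bullet> w) - 1) ^ L \<le> min 2 (norm \<xi> * h) ^ L" by (intro power_mono) auto
      moreover have "cmod (poly (map_poly complex_of_real Q) (cis (\<xi> \<bullet> w))) \<le> N"
        unfolding N_def by (rule poly_le_coeff_norm) simp
      ultimately have "cmod (A \<xi>) \<le> min 2 (norm \<xi> * h) ^ L * N"
        unfolding A using h by (simp add: norm_mult norm_power mult_mono)
      hence "(cmod (A \<xi>))\<^sup>2 \<le> (min 2 (norm \<xi> * h) ^ L * N)\<^sup>2" by (rule power_mono) simp
      thus ?thesis by (simp only: power_mult_distrib power_mult[symmetric] mult.commute)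
    qed
    have le: "\<rho> \<xi> * (cmod (A \<xi>))\<^sup>2 \<le> (C0 * h powr (2 * r)) * bessel_weight (0 + h *\<^sub>R \<xi>)" for \<xi>
    proof -
      have "\<rho> \<xi> * (cmod (A \<xi>))\<^sup>2 \<le> (c2 * bessel_weight \<xi>) * (min 2 (norm \<xi> * h) ^ (2 * L) * N\<^sup>2)"
        using \<rho>_bounds(2)[of \<xi>] Ab[of \<xi>] c2 bessel_weight_pos[of \<xi>] by (intro mult_mono) auto
      also have "\<dots> = (c2 * N\<^sup>2) * ((1 + (norm \<xi>)\<^sup>2) powr (- r) * min 2 (norm \<xi> * h) ^ (2 * L))"
        unfolding bessel_weight_def by (simp only: mult_ac)
      also have "\<dots> \<le> (c2 * N\<^sup>2) * (4 ^ L * 2 powr r * h powr (2 * r) * (1 + (h * norm \<xi>)\<^sup>2) powr (- r))"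
        using c2 by (intro mult_left_mono spectral_weight_bound h L norm_ge_zero) auto
      also have "(1 + (h * norm \<xi>)\<^sup>2) powr (- r) = bessel_weight (0 + h *\<^sub>R \<xi>)"
        using h by (simp add: bessel_weight_def)
      finally show ?thesis by (simp only: C0_def mult_ac)
    qed
    have h0: "h \<noteq> 0" using h by simp
    have "(LINT \<xi>|lborel. \<rho> \<xi> * (cmod (A \<xi>))\<^sup>2) \<le> (LINT \<xi>|lborel. (C0 * h powr (2 * r)) * bessel_weight (0 + h *\<^sub>R \<xi>))"
    proof (rule integral_mono[OF _ _ le])
      show "integrable lborel (\<lambda>\<xi>. \<rho> \<xi> * (cmod (A \<xi>))\<^sup>2)"
        unfolding A_def by (rule quadratic_form_fourier(1)) simp
      show "integrable lborel (\<lambda>\<xi>. (C0 * h powr (2 * r)) * bessel_weight (0 + h *\<^sub>R \<xi>))"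
        by (intro integrable_mult_right lborel_integral_scale(1)[OF bessel_weight_integrable h0])
    qed
    also have "\<dots> = (C0 * h powr (2 * r)) * ((1 / h ^ DIM('a)) * W)"
      unfolding integral_mult_right_zero lborel_integral_scale(2)[OF bessel_weight_integrable h0] W_def using h by simp
    also have "\<dots> = C0 * W * h powr (2 * r - DIM('a))"
      using h by (simp add: powr_diff powr_realpow)
    finally have "\<kappa> * (LINT \<xi>|lborel. \<rho> \<xi> * (cmod (A \<xi>))\<^sup>2) \<le> \<kappa> * (C0 * W * h powr (2 * r - DIM('a)))"
      using \<kappa>_pos by (intro mult_left_mono) auto
    thus "energy {..degree p} (poly.coeff p) (\<lambda>j. z + real j *\<^sub>R w) \<le> \<kappa> * C0 * W * h powr (2 * r - DIM('a))"
      unfolding energy_fourier[OF finite_atMost] A_def by (simp only: mult.assoc)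
  qed
qed

lemma difference_bound:
  fixes Q :: "real poly"
  assumes L: "r \<le> real L"
  shows "\<exists>C\<ge>0. \<forall>(I :: nat set) a x z w h. finite I \<longrightarrow> 0 < h \<longrightarrow> norm w \<le> h \<longrightarrow>
     \<bar>shift_comb (diff_poly ^ L * Q) (expansion I a x) z w\<bar>
       \<le> C * h powr (r - DIM('a) / 2) * sqrt (energy I a x)"
proof -
  obtain C where C: "C \<ge> 0" and *: "\<And>z w h. 0 < h \<Longrightarrow> norm w \<le> h \<Longrightarrow>
     energy {..degree (diff_poly ^ L * Q)} (poly.coeff (diff_poly ^ L * Q)) (\<lambda>j. z + real j *\<^sub>R w) \<le> C * h powr (2 * r - DIM('a))"
    using difference_energy_le[OF L, of Q] by blast
  show ?thesis
  proof (intro exI[of _ "sqrt C"] conjI allI impI)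
    show "0 \<le> sqrt C" using C by simp
    fix I :: "nat set" and a and x :: "nat \<Rightarrow> 'a" and z w :: 'a and h :: real
    assume I: "finite I" and h: "0 < h" and w: "norm w \<le> h"
    let ?p = "diff_poly ^ L * Q"
    have "(shift_comb ?p (expansion I a x) z w)\<^sup>2
        \<le> energy I a x * energy {..degree ?p} (poly.coeff ?p) (\<lambda>j. z + real j *\<^sub>R w)"
      unfolding shift_comb_def by (rule expansion_functional_le[OF I]) simp
    also have "\<dots> \<le> energy I a x * (C * h powr (2 * r - DIM('a)))"
      using *[OF h w] energy_nonneg[OF I] by (intro mult_left_mono) auto
    finally have "\<bar>shift_comb ?p (expansion I a x) z w\<bar> \<le> sqrt (energy I a x * (C * h powr (2 * r - DIM('a))))"
      by (rule real_le_rsqrt[of "\<bar>_\<bar>", simplified])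
    also have "\<dots> = sqrt C * sqrt (h powr (2 * r - DIM('a))) * sqrt (energy I a x)"
      by (simp only: real_sqrt_mult mult_ac)
    also have "sqrt (h powr (2 * r - DIM('a))) = h powr (r - DIM('a) / 2)"
      using h by (simp add: powr_half_sqrt[symmetric] powr_powr diff_divide_distrib)
    finally show "\<bar>shift_comb ?p (expansion I a x) z w\<bar>
       \<le> sqrt C * h powr (r - DIM('a) / 2) * sqrt (energy I a x)" .
  qed
qed

end

section \<open>The sampling inequality\<close>

text \<open>
  A cone contains balls about the points of its axis with radii proportional to the distance from
  the apex. The ratio \<open>\<sigma> = (1 - c)/(1 + c)\<close> with \<open>c = cos \<theta>\<close> works because a perturbation of \<open>te\<close> by
  at most \<open>\<sigma>t\<close> keeps the component along \<open>e\<close> above \<open>(1 - \<sigma>)t\<close> and the norm below \<open>(1 + \<sigma>)t\<close>.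
\<close>
lemma interior_cone_contains_balls:
  fixes \<Omega> :: "'a::euclidean_space set"
  assumes "interior_cone_condition \<Omega>"
  shows "\<exists>\<sigma> R. 0 < \<sigma> \<and> \<sigma> < 1 \<and> 0 < R \<and>
    (\<forall>x\<in>\<Omega>. \<exists>e. norm e = 1 \<and> (\<forall>t. 0 < t \<longrightarrow> t * (1 + \<sigma>) \<le> R \<longrightarrow> cball (x + t *\<^sub>R e) (\<sigma> * t) \<subseteq> \<Omega>))"
proof -
  obtain \<theta> R where th: "0 < \<theta>" "\<theta> < pi / 2" and R: "0 < R"
    and cone: "\<And>x. x \<in> \<Omega> \<Longrightarrow> \<exists>\<xi>. norm \<xi> = 1 \<and>
        {x + l *\<^sub>R y |l y. norm y = 1 \<and> cos \<theta> \<le> y \<bullet> \<xi> \<and> 0 \<le> l \<and> l \<le> R} \<subseteq> \<Omega>"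
    using assms unfolding interior_cone_condition_def by blast
  define c where "c = cos \<theta>"
  have c0: "0 < c" using th by (simp add: c_def cos_gt_zero)
  have c1: "c < 1" using th cos_monotone_0_pi[of 0 \<theta>] by (simp add: c_def)
  define \<sigma> where "\<sigma> = (1 - c) / (1 + c)"
  have s: "0 < \<sigma>" "\<sigma> < 1" using c0 c1 by (auto simp: \<sigma>_def)
  have sc: "(1 - \<sigma>) = c * (1 + \<sigma>)" using c0 by (simp add: \<sigma>_def field_simps)
  show ?thesis
  proof (rule exI[of _ \<sigma>], rule exI[of _ R], intro conjI ballI s R)
    fix x assume "x \<in> \<Omega>"
    then obtain e where e: "norm e = 1"
      and sub: "{x + l *\<^sub>R y |l y. norm y = 1 \<and> cos \<theta> \<le> y \<bullet> e \<and> 0 \<le> l \<and> l \<le> R} \<subseteq> \<Omega>"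
      using cone by blast
    show "\<exists>e. norm e = 1 \<and> (\<forall>t. 0 < t \<longrightarrow> t * (1 + \<sigma>) \<le> R \<longrightarrow> cball (x + t *\<^sub>R e) (\<sigma> * t) \<subseteq> \<Omega>)"
    proof (intro exI[of _ e] conjI allI impI subsetI e)
      fix t y assume t: "0 < t" "t * (1 + \<sigma>) \<le> R" and y: "y \<in> cball (x + t *\<^sub>R e) (\<sigma> * t)"
      define v where "v = y - x"
      define u where "u = v - t *\<^sub>R e"
      have u: "norm u \<le> \<sigma> * t" using y by (simp add: u_def v_def dist_norm norm_minus_commute algebra_simps)
      have vu: "v = t *\<^sub>R e + u" by (simp add: u_def)
      have v1: "norm v \<le> t * (1 + \<sigma>)"
        using norm_triangle_ineq[of "t *\<^sub>R e" u] u e t unfolding vu by (simp add: algebra_simps)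
      have "\<bar>u \<bullet> e\<bar> \<le> norm u" using Cauchy_Schwarz_ineq2[of u e] e by simp
      moreover have "v \<bullet> e = t + u \<bullet> e" using e by (simp add: vu inner_add_left norm_eq_1)
      ultimately have ve: "t * (1 - \<sigma>) \<le> v \<bullet> e" using u by (simp add: algebra_simps)
      have "0 < t * (1 - \<sigma>)" using t s by simp
      with ve have "v \<noteq> 0" by auto
      hence v0: "norm v > 0" by simp
      have "c * norm v \<le> c * (t * (1 + \<sigma>))" using v1 c0 by (intro mult_left_mono) auto
      also have "\<dots> = t * (1 - \<sigma>)" unfolding sc by (simp only: mult_ac)
      finally have "c \<le> (v /\<^sub>R norm v) \<bullet> e" using ve v0 by (simp add: field_simps)
      moreover have "y = x + norm v *\<^sub>R (v /\<^sub>R norm v)" using v0 by (simp add: v_def)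
      moreover have "norm (v /\<^sub>R norm v) = 1" using v0 by simp
      moreover have "0 \<le> norm v" "norm v \<le> R" using v1 t by auto
      ultimately have "y \<in> {x + l *\<^sub>R y |l y. norm y = 1 \<and> cos \<theta> \<le> y \<bullet> e \<and> 0 \<le> l \<and> l \<le> R}"
        unfolding c_def by blast
      thus "y \<in> \<Omega>" using sub by blast
    qed
  qed
qed

lemma shift_comb_split_0:
  "shift_comb p f z w = poly.coeff p 0 * f z + (\<Sum>k\<in>{1..degree p}. poly.coeff p k * f (z + real k *\<^sub>R w))"
proof -
  have "{..degree p} = insert 0 {1..degree p}" by auto
  thus ?thesis by (simp add: shift_comb_def)
qed

lemma sum_abs_coeff_le_coeff_norm: "(\<Sum>k\<in>{1..degree p}. \<bar>poly.coeff p k\<bar>) \<le> coeff_norm p"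
  unfolding coeff_norm_def by (rule sum_mono2) auto

context sobolev_kernel
begin

text \<open>
  Let \<open>M = sup \<bar>f\<bar>\<close> over \<open>\<Omega>\<close>. At a point \<open>z\<close> with a ball of radius \<open>Gh\<close> in \<open>\<Omega>\<close>, the step to the nearest
  node changes \<open>f\<close> by the shift combination of \<open>T\<close>, whose coefficients are small, up to a difference of
  order \<open>L\<close> (the fact \<open>near\<close>). A general point is reduced to points of this kind by a difference of
  order \<open>L\<close> along the axis of its cone, with step length \<open>Ah\<close> (the fact \<open>step\<close>). Together they bound
  \<open>M\<close> by \<open>M/2\<close> plus the right-hand side.
\<close>
lemma sampling_inequality:
  assumes cone: "interior_cone_condition \<Omega>"
  shows "\<exists>C h0. 0 \<le> C \<and> 0 < h0 \<and> (\<forall>(I :: nat set) a x X h B. finite I \<longrightarrow> 0 < h \<longrightarrow> h \<le> h0 \<longrightarrow>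
      (\<forall>z\<in>\<Omega>. \<exists>p\<in>X. norm (z - p) \<le> h) \<longrightarrow> X \<subseteq> \<Omega> \<longrightarrow> (\<forall>p\<in>X. \<bar>expansion I a x p\<bar> \<le> B) \<longrightarrow>
      (\<forall>z\<in>\<Omega>. \<bar>expansion I a x z\<bar> \<le> C * (B + h powr (r - DIM('a) / 2) * sqrt (energy I a x))))"
proof -
  define \<alpha> where "\<alpha> = r - DIM('a) / 2"
  define L where "L = nat \<lceil>r\<rceil>"
  have L: "r \<le> real L" by (simp add: L_def real_nat_ceiling_ge)
  define P where "P = diff_poly ^ L"
  have P0: "\<bar>poly.coeff P 0\<bar> = 1"
    by (simp add: P_def diff_poly_def poly_0_coeff_0[symmetric] power_abs)
  define N where "N = coeff_norm P"
  have N: "N \<ge> 1"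
    using P0 member_le_sum[of 0 "{..degree P}" "\<lambda>i. \<bar>poly.coeff P i\<bar>"] by (simp add: N_def coeff_norm_def)
  \<comment> \<open>N is the coefficient norm of (X - 1)^L, so this bound leaves the factor 1/2 for absorption.\<close>
  obtain T Q where TQ: "diff_poly ^ 1 = T + diff_poly ^ L * Q" "coeff_norm T \<le> 1 / (2 * N)"
    using diff_poly_power_small_remainder[of 1 "1 / (2 * N)" L] N by auto
  obtain \<sigma> R where \<sigma>: "0 < \<sigma>" "\<sigma> < 1" and R: "0 < R"
    and ball: "\<And>x. x \<in> \<Omega> \<Longrightarrow> \<exists>e. norm e = 1 \<and> (\<forall>t. 0 < t \<longrightarrow> t * (1 + \<sigma>) \<le> R \<longrightarrow> cball (x + t *\<^sub>R e) (\<sigma> * t) \<subseteq> \<Omega>)"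
    using interior_cone_contains_balls[OF cone] by blast
  obtain C1 where C1: "C1 \<ge> 0" and C1b: "\<And>(I :: nat set) a x z w h. finite I \<Longrightarrow> 0 < h \<Longrightarrow> norm w \<le> h \<Longrightarrow>
     \<bar>shift_comb P (expansion I a x) z w\<bar> \<le> C1 * h powr \<alpha> * sqrt (energy I a x)"
    using difference_bound[OF L, of 1] unfolding P_def \<alpha>_def mult_1_right by blast
  obtain C2 where C2: "C2 \<ge> 0" and C2b: "\<And>(I :: nat set) a x z w h. finite I \<Longrightarrow> 0 < h \<Longrightarrow> norm w \<le> h \<Longrightarrow>
     \<bar>shift_comb (diff_poly ^ L * Q) (expansion I a x) z w\<bar> \<le> C2 * h powr \<alpha> * sqrt (energy I a x)"
    using difference_bound[OF L, of Q] unfolding \<alpha>_def by blast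
  \<comment> \<open>All points at which the shift combination of T evaluates the function stay in the ball of radius G h about the starting point.\<close>
  define G where "G = real (degree T) + 1"
  have G: "G > 0" by (simp add: G_def)
  \<comment> \<open>With steps of length A h the k-th point on the axis carries a ball of radius \<sigma> k A h \<ge> G h.\<close>
  define A where "A = G / \<sigma>"
  have A: "A > 0" using G \<sigma> by (simp add: A_def)
  define d where "d = real (degree P) + 1"
  have d: "d > 0" by (simp add: d_def)
  \<comment> \<open>For h up to this bound all points used lie within the length of the cone.\<close>
  define h0 where "h0 = R / (d * A * (1 + \<sigma>))"
  have h0: "h0 > 0" using R d A \<sigma> by (simp add: h0_def)
  define C where "C = 2 * (N + N * C2 + C1 * A powr \<alpha>)"
  have C: "C \<ge> 0" using N C1 C2 by (simp add: C_def)
  show ?thesis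
  proof (rule exI[of _ C], rule exI[of _ h0], intro conjI allI impI ballI C h0)
    fix I :: "nat set" and a x and X :: "'a set" and h B :: real and z0 :: 'a
    assume I: "finite I" and h: "0 < h" "h \<le> h0" and fill: "\<forall>z\<in>\<Omega>. \<exists>p\<in>X. norm (z - p) \<le> h"
      and X: "X \<subseteq> \<Omega>" and B: "\<forall>p\<in>X. \<bar>expansion I a x p\<bar> \<le> B" and z0: "z0 \<in> \<Omega>"
    define f where "f = expansion I a x"
    define s where "s = h powr \<alpha> * sqrt (energy I a x)"
    have s0: "s \<ge> 0" using energy_nonneg[OF I] by (simp add: s_def)
    define M where "M = (SUP z\<in>\<Omega>. \<bar>f z\<bar>)"
    have bdd: "bdd_above ((\<lambda>z. \<bar>f z\<bar>) ` \<Omega>)"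
      unfolding f_def by (rule bdd_aboveI2[OF expansion_bounded])
    have fM: "\<bar>f z\<bar> \<le> M" if "z \<in> \<Omega>" for z unfolding M_def by (rule cSUP_upper[OF that bdd])
    have M0: "M \<ge> 0" using fM[OF z0] by linarith
    have B0: "B \<ge> 0" using fill z0 B by force
    have near: "\<bar>f z\<bar> \<le> B + M / (2 * N) + C2 * s" if z: "z \<in> \<Omega>" and zb: "cball z (G * h) \<subseteq> \<Omega>" for z
    proof -
      obtain p where p: "p \<in> X" "norm (z - p) \<le> h" using fill z by blast
      define w where "w = p - z"
      have w: "norm w \<le> h" using p by (simp add: w_def norm_minus_commute)
      have "f p - f z = shift_comb (diff_poly ^ 1) f z w" by (simp add: shift_comb_diff_poly w_def)
      also have "\<dots> = shift_comb T f z w + shift_comb (diff_poly ^ L * Q) f z w"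
        unfolding TQ(1) by (rule shift_comb_add)
      finally have eq: "f z = f p - shift_comb T f z w - shift_comb (diff_poly ^ L * Q) f z w" by simp
      have "\<bar>shift_comb T f z w\<bar> \<le> coeff_norm T * M"
      proof (rule shift_comb_bound)
        fix j assume j: "j \<le> degree T"
        have "real j * norm w \<le> G * h" using j w h by (intro mult_mono) (auto simp: G_def)
        hence "z + real j *\<^sub>R w \<in> cball z (G * h)" by (simp add: dist_norm)
        thus "\<bar>f (z + real j *\<^sub>R w)\<bar> \<le> M" using zb fM by blast
      qed
      also have "\<dots> \<le> 1 / (2 * N) * M" using TQ(2) M0 by (rule mult_right_mono)
      finally have 1: "\<bar>shift_comb T f z w\<bar> \<le> M / (2 * N)" by simp
      have 2: "\<bar>shift_comb (diff_poly ^ L * Q) f z w\<bar> \<le> C2 * s"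
        using C2b[OF I h(1) w, of a x z] by (simp add: f_def s_def mult.assoc)
      have 3: "\<bar>f p\<bar> \<le> B" using B p by (simp add: f_def)
      show ?thesis using 1 2 3 unfolding eq by linarith
    qed
    have step: "\<bar>f y\<bar> \<le> M / 2 + (N * B + (N * C2 + C1 * A powr \<alpha>) * s)" if y: "y \<in> \<Omega>" for y
    proof -
      obtain e where e: "norm e = 1"
        and eb: "\<And>t. 0 < t \<Longrightarrow> t * (1 + \<sigma>) \<le> R \<Longrightarrow> cball (y + t *\<^sub>R e) (\<sigma> * t) \<subseteq> \<Omega>"
        using ball[OF y] by blast
      define t where "t = A * h"
      have t: "t > 0" using A h by (simp add: t_def)
      have tR: "d * t * (1 + \<sigma>) \<le> R"
      proof -
        have "d * A * (1 + \<sigma>) * h \<le> d * A * (1 + \<sigma>) * h0"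
          using d A \<sigma> h by (intro mult_left_mono) auto
        also have "\<dots> = R" using d A \<sigma> by (simp add: h0_def)
        finally show ?thesis by (simp only: t_def mult_ac)
      qed
      have pt: "\<bar>f (y + real k *\<^sub>R (t *\<^sub>R e))\<bar> \<le> B + M / (2 * N) + C2 * s" if k: "k \<in> {1..degree P}" for k
      proof -
        have kt: "0 < real k * t" using k t by simp
        have "real k * t * (1 + \<sigma>) \<le> d * t * (1 + \<sigma>)"
          using k t \<sigma> by (intro mult_right_mono) (auto simp: d_def)
        with tR have ktR: "real k * t * (1 + \<sigma>) \<le> R" by simp
        note cb = eb[OF kt ktR]
        have "G * h = \<sigma> * t" using \<sigma> by (simp add: t_def A_def)
        also have "\<dots> \<le> \<sigma> * (real k * t)" using k t \<sigma> by (intro mult_left_mono) auto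
        finally have "cball (y + (real k * t) *\<^sub>R e) (G * h) \<subseteq> \<Omega>"
          using cb subset_cball by blast
        moreover from this have "y + (real k * t) *\<^sub>R e \<in> \<Omega>"
          using G h centre_in_cball by (meson less_imp_le mult_pos_pos subsetD)
        ultimately show ?thesis using near[of "y + (real k * t) *\<^sub>R e"] by simp
      qed
      have "\<bar>f y\<bar> = \<bar>poly.coeff P 0 * f y\<bar>" by (simp add: abs_mult P0)
      also have "\<dots> = \<bar>shift_comb P f y (t *\<^sub>R e)
          - (\<Sum>k\<in>{1..degree P}. poly.coeff P k * f (y + real k *\<^sub>R (t *\<^sub>R e)))\<bar>"
        unfolding shift_comb_split_0 by simp
      also have "\<dots> \<le> \<bar>shift_comb P f y (t *\<^sub>R e)\<bar>
          + \<bar>\<Sum>k\<in>{1..degree P}. poly.coeff P k * f (y + real k *\<^sub>R (t *\<^sub>R e))\<bar>"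
        by (rule abs_triangle_ineq4)
      also have "\<bar>shift_comb P f y (t *\<^sub>R e)\<bar> \<le> C1 * A powr \<alpha> * s"
      proof -
        have "norm (t *\<^sub>R e) \<le> t" using e t by simp
        from C1b[OF I t this, of a x y] have "\<bar>shift_comb P f y (t *\<^sub>R e)\<bar> \<le> C1 * t powr \<alpha> * sqrt (energy I a x)"
          by (simp only: f_def)
        thus ?thesis by (simp only: t_def powr_mult s_def mult_ac)
      qed
      also have "\<bar>\<Sum>k\<in>{1..degree P}. poly.coeff P k * f (y + real k *\<^sub>R (t *\<^sub>R e))\<bar>
          \<le> (\<Sum>k\<in>{1..degree P}. \<bar>poly.coeff P k\<bar> * (B + M / (2 * N) + C2 * s))"
      proof (rule order_trans[OF sum_abs], rule sum_mono)
        fix k assume "k \<in> {1..degree P}"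
        from pt[OF this] show "\<bar>poly.coeff P k * f (y + real k *\<^sub>R (t *\<^sub>R e))\<bar>
            \<le> \<bar>poly.coeff P k\<bar> * (B + M / (2 * N) + C2 * s)"
          unfolding abs_mult by (rule mult_left_mono) simp
      qed
      also have "\<dots> \<le> N * (B + M / (2 * N) + C2 * s)"
        unfolding sum_distrib_right[symmetric] N_def
        using sum_abs_coeff_le_coeff_norm[of P] B0 M0 N C2 s0
        by (intro mult_right_mono add_nonneg_nonneg) (auto simp: N_def)
      also have "\<dots> = N * B + M / 2 + N * C2 * s" using N by (simp add: distrib_left)
      finally show ?thesis by (simp add: algebra_simps)
    qed
    have "M \<le> M / 2 + (N * B + (N * C2 + C1 * A powr \<alpha>) * s)"
      unfolding M_def by (rule cSUP_least) (use z0 step[unfolded M_def] in auto)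
    hence "M \<le> 2 * (N * B + (N * C2 + C1 * A powr \<alpha>) * s)" by simp
    also have "\<dots> \<le> C * (B + s)"
    proof -
      have "0 \<le> 2 * ((N * C2 + C1 * A powr \<alpha>) * B + N * s)"
        using N C1 C2 B0 s0 by simp
      thus ?thesis by (simp add: C_def algebra_simps)
    qed
    finally show "\<bar>expansion I a x z0\<bar> \<le> C * (B + h powr (r - DIM('a) / 2) * sqrt (energy I a x))"
      using fM[OF z0] by (simp add: f_def s_def \<alpha>_def)
  qed
qed

end

section \<open>Geometry of scattered points\<close>

lemma separation_distance_finite:
  assumes "finite X"
  shows "finite {norm (p - q) |p q. p \<in> X \<and> q \<in> X \<and> p \<noteq> q}"
proof (rule finite_subset)
  show "{norm (p - q) |p q. p \<in> X \<and> q \<in> X \<and> p \<noteq> q} \<subseteq> (\<lambda>(p, q). norm (p - q)) ` (X \<times> X)" by auto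
qed (use assms in auto)

lemma separation_distance_le:
  assumes "finite X" "p \<in> X" "q \<in> X" "p \<noteq> q"
  shows "2 * separation_distance X \<le> norm (p - q)"
proof -
  have "Min {norm (p - q) |p q. p \<in> X \<and> q \<in> X \<and> p \<noteq> q} \<le> norm (p - q)"
    using assms by (intro Min_le separation_distance_finite) blast+
  thus ?thesis by (simp add: separation_distance_def)
qed

lemma separation_distance_pos:
  assumes "finite X" "p \<in> X" "q \<in> X" "p \<noteq> q"
  shows "0 < separation_distance X"
proof -
  have "Min {norm (p - q) |p q. p \<in> X \<and> q \<in> X \<and> p \<noteq> q} \<in> {norm (p - q) |p q. p \<in> X \<and> q \<in> X \<and> p \<noteq> q}"
    using assms by (intro Min_in separation_distance_finite) blast+
  hence "0 < Min {norm (p - q) |p q. p \<in> X \<and> q \<in> X \<and> p \<noteq> q}" by auto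
  thus ?thesis by (simp add: separation_distance_def)
qed

lemma Min_dist_le_fill_distance:
  assumes "bounded \<Omega>" "finite X" "X \<noteq> {}" "z \<in> \<Omega>"
  shows "Min ((\<lambda>p. norm (z - p)) ` X) \<le> fill_distance X \<Omega>"
  unfolding fill_distance_def
proof (rule cSUP_upper[OF assms(4)])
  obtain b where b: "\<And>x. x \<in> \<Omega> \<Longrightarrow> norm x \<le> b" using assms(1) by (auto simp: bounded_iff)
  obtain p where p: "p \<in> X" using assms by blast
  show "bdd_above ((\<lambda>z. Min ((\<lambda>p. norm (z - p)) ` X)) ` \<Omega>)"
  proof (rule bdd_aboveI2)
    fix z assume z: "z \<in> \<Omega>"
    have "Min ((\<lambda>p. norm (z - p)) ` X) \<le> norm (z - p)" using assms p by (intro Min_le) auto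
    also have "\<dots> \<le> b + norm p" using b[OF z] norm_triangle_ineq4[of z p] by linarith
    finally show "Min ((\<lambda>p. norm (z - p)) ` X) \<le> b + norm p" .
  qed
qed

lemma fill_distance_nearest:
  assumes "bounded \<Omega>" "finite X" "X \<noteq> {}" "z \<in> \<Omega>"
  shows "\<exists>p\<in>X. norm (z - p) \<le> fill_distance X \<Omega>"
proof -
  have "Min ((\<lambda>p. norm (z - p)) ` X) \<in> (\<lambda>p. norm (z - p)) ` X" using assms by (intro Min_in) auto
  then obtain p where "p \<in> X" "Min ((\<lambda>p. norm (z - p)) ` X) = norm (z - p)" by blast
  thus ?thesis using Min_dist_le_fill_distance[OF assms] by auto
qed

text \<open>
  From a node, move a distance \<open>t \<le> q\<close> inside \<open>\<Omega>\<close> along the axis of its cone. The other nodes are at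
  distance at least \<open>2q - t \<ge> t\<close> from the point reached.
\<close>
lemma separation_le_fill_distance:
  fixes \<Omega> :: "'a::euclidean_space set"
  assumes cone: "interior_cone_condition \<Omega>" and bd: "bounded \<Omega>"
  shows "\<exists>R>0. \<forall>X. finite X \<longrightarrow> X \<subseteq> \<Omega> \<longrightarrow> (\<exists>p\<in>X. \<exists>q\<in>X. p \<noteq> q) \<longrightarrow>
    min (separation_distance X) R \<le> fill_distance X \<Omega>"
proof -
  obtain \<sigma> R where \<sigma>: "0 < \<sigma>" "\<sigma> < 1" and R: "0 < R"
    and ball: "\<And>x. x \<in> \<Omega> \<Longrightarrow> \<exists>e. norm e = 1 \<and> (\<forall>t. 0 < t \<longrightarrow> t * (1 + \<sigma>) \<le> R \<longrightarrow> cball (x + t *\<^sub>R e) (\<sigma> * t) \<subseteq> \<Omega>)"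
    using interior_cone_contains_balls[OF cone] by blast
  show ?thesis
  proof (rule exI[of _ "R / (1 + \<sigma>)"], intro conjI allI impI)
    show "0 < R / (1 + \<sigma>)" using R \<sigma> by simp
    fix X assume X: "finite X" "X \<subseteq> \<Omega>" and two: "\<exists>p\<in>X. \<exists>q\<in>X. p \<noteq> q"
    then obtain p q where pq: "p \<in> X" "q \<in> X" "p \<noteq> q" by blast
    define t where "t = min (separation_distance X) (R / (1 + \<sigma>))"
    have t: "0 < t" "t \<le> separation_distance X" "t \<le> R / (1 + \<sigma>)"
      using separation_distance_pos[OF X(1) pq] R \<sigma> by (auto simp: t_def)
    have tR: "t * (1 + \<sigma>) \<le> R" using t(3) \<sigma> by (simp add: le_divide_eq)
    obtain e where e: "norm e = 1" and cb: "cball (p + t *\<^sub>R e) (\<sigma> * t) \<subseteq> \<Omega>"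
      using ball[of p] X pq t tR by blast
    define y where "y = p + t *\<^sub>R e"
    have y: "y \<in> \<Omega>" using cb t \<sigma> by (auto simp: y_def subset_iff)
    have yp: "norm (y - p) = t" using e t by (simp add: y_def)
    have "t \<le> norm (y - p')" if p': "p' \<in> X" for p'
    proof (cases "p' = p")
      case False
      have "2 * separation_distance X \<le> norm (p' - p)"
        using separation_distance_le[OF X(1) p' pq(1) False] .
      also have "\<dots> \<le> norm (y - p) + norm (y - p')"
        using norm_triangle_ineq4[of "y - p" "y - p'"] by simp
      finally show ?thesis using yp t by simp
    qed (use yp in simp)
    hence "t \<le> Min ((\<lambda>p. norm (y - p)) ` X)" using X pq by (subst Min_ge_iff) auto
    also have "\<dots> \<le> fill_distance X \<Omega>" using X pq bd y by (intro Min_dist_le_fill_distance) auto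
    finally show "min (separation_distance X) (R / (1 + \<sigma>)) \<le> fill_distance X \<Omega>" by (simp add: t_def)
  qed
qed

text \<open>
  The balls about the nodes with the fill distance as radius cover a fixed ball inside \<open>\<Omega>\<close>.
\<close>
lemma fill_distance_volume:
  fixes \<Omega> :: "'a::euclidean_space set"
  assumes op: "open \<Omega>" and bd: "bounded \<Omega>" and ne: "\<Omega> \<noteq> {}"
  shows "\<exists>v>0. \<forall>X. finite X \<longrightarrow> X \<noteq> {} \<longrightarrow> 0 \<le> fill_distance X \<Omega> \<longrightarrow>
    v \<le> real (card X) * fill_distance X \<Omega> ^ DIM('a)"
proof -
  obtain z e where z: "e > 0" "ball z e \<subseteq> \<Omega>" using op ne by (meson ex_in_conv open_contains_ball)
  define V where "V = unit_ball_vol (real DIM('a))"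
  have V: "V > 0" unfolding V_def by (rule unit_ball_vol_pos) simp
  show ?thesis
  proof (rule exI[of _ "(e / 2) ^ DIM('a)"], intro conjI allI impI)
    show "0 < (e / 2) ^ DIM('a)" using z by simp
    fix X :: "'a set" assume X: "finite X" "X \<noteq> {}" and h0: "0 \<le> fill_distance X \<Omega>"
    define h where "h = fill_distance X \<Omega>"
    have cover: "cball z (e / 2) \<subseteq> (\<Union>p\<in>X. cball p h)"
    proof
      fix y assume "y \<in> cball z (e / 2)"
      hence "y \<in> \<Omega>" using z by (auto simp: subset_iff)
      thus "y \<in> (\<Union>p\<in>X. cball p h)"
        using fill_distance_nearest[OF bd X] by (fastforce simp: h_def dist_norm norm_minus_commute)
    qed
    have "V * (e / 2) ^ DIM('a) = measure lborel (cball z (e / 2))"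
      using z content_cball[of "e / 2" z] by (simp add: V_def)
    also have "\<dots> \<le> measure lborel (\<Union>p\<in>X. cball p h)"
    proof (rule measure_mono_fmeasurable[OF cover])
      have "compact (\<Union>p\<in>X. cball p h)" using X by (intro compact_UN) auto
      thus "(\<Union>p\<in>X. cball p h) \<in> fmeasurable lborel"
        by (intro fmeasurableI emeasure_bounded_finite compact_imp_bounded) (auto intro: borel_compact)
    qed simp
    also have "\<dots> \<le> (\<Sum>p\<in>X. measure lborel (cball p h))" using X by (intro measure_UNION_le) auto
    also have "\<dots> = V * (real (card X) * h ^ DIM('a))"
      using h0 by (simp add: content_cball h_def V_def)
    finally show "(e / 2) ^ DIM('a) \<le> real (card X) * fill_distance X \<Omega> ^ DIM('a)"
      using V by (simp add: h_def)
  qed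
qed

text \<open>
  A bounded set is covered by finitely many balls of radius \<open>\<epsilon>\<close>, so among
  more nodes than balls two share a ball.
\<close>
lemma separation_distance_eventually_small:
  fixes \<Omega> :: "'a::euclidean_space set"
  assumes bd: "bounded \<Omega>" and \<epsilon>: "\<epsilon> > 0"
  shows "\<exists>k. \<forall>X. finite X \<longrightarrow> X \<subseteq> \<Omega> \<longrightarrow> k < card X \<longrightarrow> separation_distance X < \<epsilon>"
proof -
  have comp: "compact (closure \<Omega>)" using bd by simp
  have cover: "closure \<Omega> \<subseteq> (\<Union>c\<in>closure \<Omega>. ball c \<epsilon>)" using \<epsilon> by auto
  obtain F where F: "F \<subseteq> closure \<Omega>" "finite F" "closure \<Omega> \<subseteq> (\<Union>c\<in>F. ball c \<epsilon>)"
    by (rule compactE_image[OF comp _ cover]) auto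
  show ?thesis
  proof (rule exI[of _ "card F"], intro allI impI)
    fix X assume X: "finite X" "X \<subseteq> \<Omega>" "card F < card X"
    have "\<forall>p\<in>X. \<exists>c\<in>F. p \<in> ball c \<epsilon>" using X F closure_subset by blast
    then obtain g where g: "\<And>p. p \<in> X \<Longrightarrow> g p \<in> F \<and> p \<in> ball (g p) \<epsilon>" by metis
    have "card (g ` X) \<le> card F" using g F by (intro card_mono) auto
    hence "\<not> inj_on g X" using X by (intro pigeonhole) simp
    then obtain p q where pq: "p \<in> X" "q \<in> X" "p \<noteq> q" "g p = g q" by (auto simp: inj_on_def)
    have "2 * separation_distance X \<le> dist p q"
      using separation_distance_le[OF X(1) pq(1-3)] by (simp add: dist_norm)
    also have "\<dots> \<le> dist (g p) p + dist (g p) q" by (rule dist_triangle3)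
    also have "\<dots> < 2 * \<epsilon>" using g[OF pq(1)] g[OF pq(2)] pq(4) by simp
    finally show "separation_distance X < \<epsilon>" by simp
  qed
qed

section \<open>Lebesgue constants of Bayesian quadrature\<close>

context sobolev_kernel
begin

lemma kernel_matrix_inverse:
  fixes y :: "nat \<Rightarrow> 'a"
  assumes inj: "inj_on y {..<n}"
  defines "K \<equiv> kernel_matrix (\<lambda>u v. \<Phi> (u - v)) n y"
  shows "\<exists>B. mat_inverse K = Some B \<and> B \<in> carrier_mat n n \<and> K * B = 1\<^sub>m n"
proof -
  have K: "K \<in> carrier_mat n n" by (simp add: K_def kernel_matrix_def)
  have "Determinant.det K \<noteq> 0"
  proof
    assume "Determinant.det K = 0"
    then obtain v where v: "v \<in> carrier_vec n" "v \<noteq> 0\<^sub>v n" "K *\<^sub>v v = 0\<^sub>v n"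
      using det_0_iff_vec_prod_zero[OF K] by blast
    obtain i0 where i0: "i0 < n" "v $ i0 \<noteq> 0"
      using v(1,2) by (metis eq_vecI carrier_vecD index_zero_vec(1) index_zero_vec(2))
    \<comment> \<open>Positive definiteness speaks of coefficients attached to points, hence the passage from indices
      to points.\<close>
    define g where "g = the_inv_into {..<n} y"
    define c where "c p = v $ g p" for p
    have g: "g (y i) = i" if "i < n" for i using that inj by (simp add: g_def the_inv_into_f_f)
    have "0 < (\<Sum>p\<in>y ` {..<n}. \<Sum>q\<in>y ` {..<n}. c p * c q * \<Phi> (p - q))"
      using i0 g by (intro quadratic_form_pos) (auto simp: c_def)
    also have "\<dots> = (\<Sum>i<n. \<Sum>j<n. v $ i * v $ j * \<Phi> (y i - y j))"
      unfolding sum.reindex[OF inj] o_def c_def by (intro sum.cong refl) (simp add: g)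
    also have "\<dots> = (\<Sum>i<n. v $ i * (\<Sum>j<n. \<Phi> (y j - y i) * v $ j))"
      unfolding sum_distrib_left
      by (intro sum.cong refl) (metis \<Phi>_even minus_diff_eq mult.assoc mult.commute)
    also have "\<dots> = (\<Sum>i<n. v $ i * (K *\<^sub>v v) $ i)"
      using v(1) by (intro sum.cong refl) (simp add: K_def kernel_matrix_def scalar_prod_def lessThan_atLeast0)
    also have "\<dots> = 0" unfolding v(3) by simp
    finally show False by simp
  qed
  hence "K \<in> Units (ring_mat TYPE(real) n ())" by (rule det_non_zero_imp_unit[OF K])
  hence "mat_inverse K \<noteq> None" using mat_inverse(1)[OF K, where b = "()"] by blast
  then obtain B where "mat_inverse K = Some B" by blast
  thus ?thesis using mat_inverse(2)[OF K] by blast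
qed

lemma kernel_system_solvable:
  fixes y :: "nat \<Rightarrow> 'a" and s :: "nat \<Rightarrow> real"
  assumes inj: "inj_on y {..<n}"
  defines "K \<equiv> kernel_matrix (\<lambda>u v. \<Phi> (u - v)) n y"
  defines "a \<equiv> the (mat_inverse K) *\<^sub>v Matrix.vec n s"
  assumes i: "i < n"
  shows "(\<Sum>j<n. \<Phi> (y i - y j) * a $ j) = s i"
proof -
  obtain B where B: "mat_inverse K = Some B" "B \<in> carrier_mat n n" "K * B = 1\<^sub>m n"
    using kernel_matrix_inverse[OF inj] unfolding K_def by blast
  have K: "K \<in> carrier_mat n n" by (simp add: K_def kernel_matrix_def)
  have aB: "a = B *\<^sub>v Matrix.vec n s" by (simp add: a_def B)
  have ac: "a \<in> carrier_vec n" unfolding aB using B(2) by (intro mult_mat_vec_carrier) auto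
  have "K *\<^sub>v a = (K * B) *\<^sub>v Matrix.vec n s"
    unfolding aB using K B(2) by (intro assoc_mult_mat_vec[symmetric]) auto
  also have "\<dots> = Matrix.vec n s" unfolding B(3) by simp
  finally have "(K *\<^sub>v a) $ i = s i" using i by simp
  moreover have "(K *\<^sub>v a) $ i = (\<Sum>j<n. \<Phi> (y j - y i) * a $ j)"
    using i ac by (simp add: K_def kernel_matrix_def scalar_prod_def lessThan_atLeast0)
  moreover have "\<Phi> (y j - y i) = \<Phi> (y i - y j)" for j by (metis \<Phi>_even minus_diff_eq)
  ultimately show ?thesis by simp
qed

text \<open>
  With \<open>s\<close> the signs of the weights \<open>w = K\<^bsup>-1\<^esup>z\<close> and \<open>a = K\<^bsup>-1\<^esup>s\<close>, symmetry of \<open>K\<close> gives \<open>s\<bullet>w = a\<bullet>z\<close>,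
  and the right-hand side is the integral of the interpolant of \<open>s\<close>.
\<close>
lemma bq_lebesgue_constant_eq_integral:
  fixes y :: "nat \<Rightarrow> 'a"
  assumes inj: "inj_on y {..<n}"
    and \<nu>: "prob_space \<nu>" "sets \<nu> = sets (restrict_space borel \<Omega>)"
  shows "\<exists>a s. (\<forall>i<n. expansion {..<n} a y (y i) = s i \<and> \<bar>s i\<bar> \<le> 1) \<and>
     bq_lebesgue_constant (\<lambda>u v. \<Phi> (u - v)) \<nu> n y = (LINT u|\<nu>. expansion {..<n} a y u)"
proof -
  interpret prob_space \<nu> by (rule \<nu>(1))
  define w where "w = bq_weights (\<lambda>u v. \<Phi> (u - v)) \<nu> n y"
  define z where "z i = kernel_mean (\<lambda>u v. \<Phi> (u - v)) \<nu> (y i)" for i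
  define s where "s i = sgn (w $ i)" for i
  define a where "a j = (the (mat_inverse (kernel_matrix (\<lambda>u v. \<Phi> (u - v)) n y)) *\<^sub>v Matrix.vec n s) $ j" for j
  have a: "(\<Sum>j<n. \<Phi> (y i - y j) * a j) = s i" if "i < n" for i
    unfolding a_def by (rule kernel_system_solvable[OF inj that])
  have w: "(\<Sum>j<n. \<Phi> (y i - y j) * w $ j) = z i" if "i < n" for i
    using kernel_system_solvable[OF inj that, of z] unfolding w_def bq_weights_def z_def .
  have m: "(\<lambda>u. \<Phi> (u - p)) \<in> borel_measurable \<nu>" for p
  proof -
    have "(\<lambda>u. \<Phi> (u - p)) \<in> borel_measurable borel" by measurable
    hence "(\<lambda>u. \<Phi> (u - p)) \<in> borel_measurable (restrict_space borel \<Omega>)" by (rule measurable_restrict_space1)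
    thus ?thesis using measurable_cong_sets[OF \<nu>(2) refl] by blast
  qed
  have i: "integrable \<nu> (\<lambda>u. \<Phi> (u - p))" for p
    by (rule integrable_const_bound[where B = "\<Phi> 0"]) (auto intro: abs_\<Phi>_le m)
  have "bq_lebesgue_constant (\<lambda>u v. \<Phi> (u - v)) \<nu> n y = (\<Sum>i<n. s i * w $ i)"
    unfolding bq_lebesgue_constant_def w_def[symmetric] s_def
    by (intro sum.cong refl) (simp add: abs_sgn mult.commute)
  also have "\<dots> = (\<Sum>i<n. \<Sum>j<n. (\<Phi> (y i - y j) * a j) * w $ i)"
    unfolding sum_distrib_right[symmetric] by (intro sum.cong refl) (simp add: a)
  also have "\<dots> = (\<Sum>j<n. \<Sum>i<n. (\<Phi> (y i - y j) * a j) * w $ i)" by (rule sum.swap)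
  also have "\<dots> = (\<Sum>j<n. a j * (\<Sum>i<n. \<Phi> (y j - y i) * w $ i))"
    unfolding sum_distrib_left
    by (intro sum.cong refl) (metis \<Phi>_even minus_diff_eq mult.assoc mult.commute)
  also have "\<dots> = (\<Sum>j<n. a j * z j)" by (intro sum.cong refl) (simp add: w)
  also have "\<dots> = (LINT u|\<nu>. expansion {..<n} a y u)"
    unfolding z_def kernel_mean_def expansion_def using i by simp
  finally have "bq_lebesgue_constant (\<lambda>u v. \<Phi> (u - v)) \<nu> n y = (LINT u|\<nu>. expansion {..<n} a y u)" .
  moreover have "expansion {..<n} a y (y i) = s i \<and> \<bar>s i\<bar> \<le> 1" if "i < n" for i
    using a[OF that] by (auto simp: expansion_def mult.commute s_def abs_sgn_eq)
  ultimately show ?thesis by blast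
qed

text \<open>
  The energy \<open>E\<close> is the pairing of the coefficients \<open>a\<close> with the data, so \<open>E\<^sup>2 \<le> n \<Sum>a\<^sub>i\<^sup>2\<close>, and
  coercivity bounds \<open>\<Sum>a\<^sub>i\<^sup>2\<close> by a multiple of \<open>E\<close>.
\<close>
lemma interpolant_energy_le:
  "\<exists>C>0. \<forall>n (y :: nat \<Rightarrow> 'a) a q. 0 < q \<longrightarrow> q \<le> 1 \<longrightarrow>
     (\<forall>i<n. \<forall>j<n. i \<noteq> j \<longrightarrow> 2 * q \<le> norm (y i - y j)) \<longrightarrow>
     (\<forall>i<n. \<bar>expansion {..<n} a y (y i)\<bar> \<le> 1) \<longrightarrow>
     sqrt (energy {..<n} a y) \<le> C * sqrt (real n) / q powr (r - DIM('a) / 2)"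
proof -
  obtain lo where lo: "lo > 0" and co: "\<And>(I :: nat set) y c q. finite I \<Longrightarrow> 0 < q \<Longrightarrow> q \<le> 1 \<Longrightarrow>
     (\<forall>i\<in>I. \<forall>j\<in>I. i \<noteq> j \<longrightarrow> 2 * q \<le> norm (y i - y j)) \<Longrightarrow>
     lo * q powr (2 * r - DIM('a)) * (\<Sum>i\<in>I. (c i)\<^sup>2) \<le> (\<Sum>i\<in>I. \<Sum>j\<in>I. c i * c j * \<Phi> (y i - y j))"
    using kernel_matrix_coercive by blast
  show ?thesis
  proof (rule exI[of _ "1 / sqrt lo"], intro conjI allI impI)
    show "0 < 1 / sqrt lo" using lo by simp
    fix n and y :: "nat \<Rightarrow> 'a" and a and q :: real
    assume q: "0 < q" "q \<le> 1" and sep: "\<forall>i<n. \<forall>j<n. i \<noteq> j \<longrightarrow> 2 * q \<le> norm (y i - y j)"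
      and le1: "\<forall>i<n. \<bar>expansion {..<n} a y (y i)\<bar> \<le> 1"
    define E where "E = energy {..<n} a y"
    define A where "A = (\<Sum>i<n. (a i)\<^sup>2)"
    define \<alpha> where "\<alpha> = r - DIM('a) / 2"
    have E0: "E \<ge> 0" unfolding E_def by (rule energy_nonneg) simp
    have qp: "q powr (2 * r - DIM('a)) = (q powr \<alpha>)\<^sup>2"
    proof -
      have "2 * r - DIM('a) = \<alpha> + \<alpha>" by (simp add: \<alpha>_def)
      thus ?thesis by (simp only: powr_add power2_eq_square)
    qed
    have low: "lo * (q powr \<alpha>)\<^sup>2 * A \<le> E"
      unfolding qp[symmetric] A_def E_def energy_def by (rule co) (use q sep in auto)
    have "E = (\<Sum>i<n. a i * expansion {..<n} a y (y i))"
      by (simp add: E_def energy_def expansion_def sum_distrib_left mult.assoc)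
    hence "E\<^sup>2 \<le> A * (\<Sum>i<n. (expansion {..<n} a y (y i))\<^sup>2)"
      unfolding A_def using Cauchy_Schwarz_ineq_sum[of a _ "{..<n}"] by simp
    also have "\<dots> \<le> A * (\<Sum>i<n. 1)"
      using le1 by (intro mult_left_mono sum_mono) (auto simp: A_def abs_square_le_1 intro!: sum_nonneg)
    finally have up: "E\<^sup>2 \<le> A * real n" by simp
    define k where "k = lo * (q powr \<alpha>)\<^sup>2"
    have k: "k > 0" using lo q by (simp add: k_def)
    have "k * E\<^sup>2 \<le> k * (A * real n)" using up k by (intro mult_left_mono) auto
    also have "\<dots> = (k * A) * real n" by simp
    also have "\<dots> \<le> E * real n" using low by (intro mult_right_mono) (auto simp: k_def)
    finally have "E * (k * E) \<le> E * real n" by (simp add: power2_eq_square mult_ac)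
    hence "k * E \<le> real n" using E0 by (cases "E = 0") auto
    hence "E \<le> real n / k" using k by (simp add: le_divide_eq mult.commute)
    hence "sqrt E \<le> sqrt (real n / k)" by simp
    also have "\<dots> = 1 / sqrt lo * sqrt (real n) / q powr \<alpha>"
      using q by (simp add: k_def real_sqrt_divide real_sqrt_mult)
    finally show "sqrt (energy {..<n} a y) \<le> 1 / sqrt lo * sqrt (real n) / q powr (r - DIM('a) / 2)"
      by (simp only: E_def \<alpha>_def)
  qed
qed

lemma bq_lebesgue_constant_le:
  assumes cone: "interior_cone_condition \<Omega>" and bd: "bounded \<Omega>"
    and \<nu>: "prob_space \<nu>" "sets \<nu> = sets (restrict_space borel \<Omega>)"
  shows "\<exists>C h0. 0 < C \<and> 0 < h0 \<and> (\<forall>n y. 2 \<le> n \<longrightarrow> inj_on y {..<n} \<longrightarrow> y ` {..<n} \<subseteq> \<Omega> \<longrightarrow>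
     fill_distance (y ` {..<n}) \<Omega> \<le> h0 \<longrightarrow>
     separation_distance (y ` {..<n}) \<le> fill_distance (y ` {..<n}) \<Omega> \<and>
     bq_lebesgue_constant (\<lambda>u v. \<Phi> (u - v)) \<nu> n y
       \<le> C * sqrt (real n) * (fill_distance (y ` {..<n}) \<Omega> / separation_distance (y ` {..<n})) powr (r - DIM('a) / 2))"
proof -
  interpret prob_space \<nu> by (rule \<nu>(1))
  define \<alpha> where "\<alpha> = r - DIM('a) / 2"
  have \<alpha>: "\<alpha> > 0" using r by (simp add: \<alpha>_def)
  obtain C1 h1 where C1: "0 \<le> C1" and h1: "0 < h1"
    and samp: "\<forall>(I :: nat set) a x X h B. finite I \<longrightarrow> 0 < h \<longrightarrow> h \<le> h1 \<longrightarrow>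
      (\<forall>z\<in>\<Omega>. \<exists>p\<in>X. norm (z - p) \<le> h) \<longrightarrow> X \<subseteq> \<Omega> \<longrightarrow> (\<forall>p\<in>X. \<bar>expansion I a x p\<bar> \<le> B) \<longrightarrow>
      (\<forall>z\<in>\<Omega>. \<bar>expansion I a x z\<bar> \<le> C1 * (B + h powr \<alpha> * sqrt (energy I a x)))"
    using sampling_inequality[OF cone] unfolding \<alpha>_def by (elim exE conjE)
  obtain C2 where C2: "C2 > 0" and en: "\<forall>n (y :: nat \<Rightarrow> 'a) a q. 0 < q \<longrightarrow> q \<le> 1 \<longrightarrow>
     (\<forall>i<n. \<forall>j<n. i \<noteq> j \<longrightarrow> 2 * q \<le> norm (y i - y j)) \<longrightarrow>
     (\<forall>i<n. \<bar>expansion {..<n} a y (y i)\<bar> \<le> 1) \<longrightarrow>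
     sqrt (energy {..<n} a y) \<le> C2 * sqrt (real n) / q powr \<alpha>"
    using interpolant_energy_le unfolding \<alpha>_def by (elim exE conjE)
  obtain R where R: "R > 0" and sf: "\<And>X. finite X \<Longrightarrow> X \<subseteq> \<Omega> \<Longrightarrow> (\<exists>p\<in>X. \<exists>q\<in>X. p \<noteq> q) \<Longrightarrow>
    min (separation_distance X) R \<le> fill_distance X \<Omega>"
    using separation_le_fill_distance[OF cone bd] by blast
  \<comment> \<open>The bound R / 2 excludes that the minimum of q and R is attained by R; the bound 1 gives q \<le> 1.\<close>
  define h0 where "h0 = min (min h1 (R / 2)) 1"
  have sp: "space \<nu> = \<Omega>" using sets_eq_imp_space_eq[OF \<nu>(2)] by (simp add: space_restrict_space)
  show ?thesis
  proof (rule exI[of _ "C1 + C1 * C2 + 1"], rule exI[of _ h0], intro conjI allI impI)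
    show "0 < C1 + C1 * C2 + 1" using C1 C2 by (intro add_nonneg_pos) auto
    show "0 < h0" using h1 R by (simp add: h0_def)
    fix n and y :: "nat \<Rightarrow> 'a"
    assume n: "2 \<le> n" and inj: "inj_on y {..<n}" and sub: "y ` {..<n} \<subseteq> \<Omega>"
      and fh: "fill_distance (y ` {..<n}) \<Omega> \<le> h0"
    define X where "X = y ` {..<n}"
    define h where "h = fill_distance X \<Omega>"
    define q where "q = separation_distance X"
    have X: "finite X" "X \<subseteq> \<Omega>" using sub by (auto simp: X_def)
    have y01: "y 0 \<in> X" "y 1 \<in> X" "y 0 \<noteq> y 1"
      using n inj_on_eq_iff[OF inj, of 0 1] by (auto simp: X_def)
    have q: "q > 0" unfolding q_def by (rule separation_distance_pos[OF X(1) y01])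
    have hh: "h \<le> h0" using fh by (simp add: h_def X_def)
    have "min q R \<le> h" unfolding q_def h_def using X y01 by (intro sf) blast+
    hence "q \<le> h \<or> R \<le> h" by (simp only: min_le_iff_disj)
    moreover have hR: "h \<le> h1" "h \<le> R / 2" "h \<le> 1" using hh unfolding h0_def by simp_all
    ultimately have qh: "q \<le> h" using R by linarith
    show "separation_distance (y ` {..<n}) \<le> fill_distance (y ` {..<n}) \<Omega>" using qh by (simp only: q_def h_def X_def)
    have h: "0 < h" "h \<le> h1" "h \<le> 1" using q qh hR by linarith+
    obtain a s where as: "\<And>i. i < n \<Longrightarrow> expansion {..<n} a y (y i) = s i \<and> \<bar>s i\<bar> \<le> 1"
      and bq: "bq_lebesgue_constant (\<lambda>u v. \<Phi> (u - v)) \<nu> n y = (LINT u|\<nu>. expansion {..<n} a y u)"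
      using bq_lebesgue_constant_eq_integral[OF inj \<nu>] by blast
    have E: "sqrt (energy {..<n} a y) \<le> C2 * sqrt (real n) / q powr \<alpha>"
    proof -
      have "\<forall>i<n. \<forall>j<n. i \<noteq> j \<longrightarrow> 2 * q \<le> norm (y i - y j)"
      proof (intro allI impI)
        fix i j assume ij: "i < n" "j < n" "i \<noteq> j"
        hence "y i \<noteq> y j" using inj_on_eq_iff[OF inj, of i j] by simp
        thus "2 * q \<le> norm (y i - y j)"
          unfolding q_def using ij by (intro separation_distance_le[OF X(1)]) (auto simp: X_def)
      qed
      moreover have "\<forall>i<n. \<bar>expansion {..<n} a y (y i)\<bar> \<le> 1" using as by simp
      moreover have "q \<le> 1" using qh h by linarith
      ultimately show ?thesis using en q by metis
    qed
    define F where "F = C1 * (1 + h powr \<alpha> * sqrt (energy {..<n} a y))"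
    have F: "\<bar>expansion {..<n} a y z\<bar> \<le> F" if "z \<in> \<Omega>" for z
    proof -
      have "\<forall>z\<in>\<Omega>. \<exists>p\<in>X. norm (z - p) \<le> h"
        unfolding h_def using y01 by (intro ballI fill_distance_nearest bd X) auto
      moreover have "\<forall>p\<in>X. \<bar>expansion {..<n} a y p\<bar> \<le> 1" using as by (auto simp: X_def)
      moreover note samp[THEN spec[of _ "{..<n}"], THEN spec[of _ a], THEN spec[of _ y], THEN spec[of _ X],
          THEN spec[of _ h], THEN spec[of _ 1]]
      ultimately show ?thesis unfolding F_def using h X that by (simp only: finite_lessThan)
    qed
    have F0: "0 \<le> F" unfolding F_def using C1 energy_nonneg[of "{..<n}" a y] by simp
    have "bq_lebesgue_constant (\<lambda>u v. \<Phi> (u - v)) \<nu> n y \<le> (LINT u|\<nu>. F)"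
      unfolding bq
    proof (rule integral_mono')
      fix u assume "u \<in> space \<nu>"
      thus "expansion {..<n} a y u \<le> F" using F[of u] by (simp add: sp)
    qed (use F0 in auto)
    also have "\<dots> = F" using prob_space by simp
    also have "F \<le> C1 * (1 + h powr \<alpha> * (C2 * sqrt (real n) / q powr \<alpha>))"
      unfolding F_def using C1 E by (intro mult_left_mono add_left_mono) auto
    also have "\<dots> = C1 * (1 + C2 * (sqrt (real n) * (h / q) powr \<alpha>))"
      unfolding powr_divide by simp
    also have "\<dots> \<le> (C1 + C1 * C2 + 1) * (sqrt (real n) * (h / q) powr \<alpha>)"
    proof -
      define t where "t = sqrt (real n) * (h / q) powr \<alpha>"
      have "1 \<le> sqrt (real n)" using n by simp
      moreover have "1 \<le> (h / q) powr \<alpha>"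
        using q qh \<alpha> by (intro ge_one_powr_ge_zero) (simp_all add: le_divide_eq)
      ultimately have "1 * 1 \<le> t" unfolding t_def by (intro mult_mono) auto
      hence "0 \<le> C1 * (t - 1) + t" using C1 by (intro add_nonneg_nonneg mult_nonneg_nonneg) auto
      thus ?thesis unfolding t_def[symmetric] by (simp add: algebra_simps)
    qed
    finally show "bq_lebesgue_constant (\<lambda>u v. \<Phi> (u - v)) \<nu> n y
       \<le> (C1 + C1 * C2 + 1) * sqrt (real n) * (fill_distance (y ` {..<n}) \<Omega> / separation_distance (y ` {..<n})) powr (r - DIM('a) / 2)"
      by (simp only: h_def q_def X_def \<alpha>_def mult.assoc)
  qed
qed

end

theorem corollary3:
  fixes \<Omega> :: "'a::euclidean_space set"
    and \<nu> :: "'a measure"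
    and \<Phi> :: "'a \<Rightarrow> real"
    and k :: "'a \<Rightarrow> 'a \<Rightarrow> real"
    and r c1 c2 :: real
    and x :: "nat \<Rightarrow> nat \<Rightarrow> 'a"
  assumes "bounded \<Omega>" and "open \<Omega>"
    and "interior_cone_condition \<Omega>"
    and "lipschitz_boundary \<Omega>"
    and "probability_with_bounded_density \<Omega> \<nu>"
    and "k = (\<lambda>y y'. \<Phi> (y - y'))"
    and "continuous_on UNIV \<Phi>"
    and "integrable lborel \<Phi>"
    and "positive_definite_function \<Phi>"
    and "r > real DIM('a) / 2" and "c1 > 0" and "c2 > 0"
    and "\<And>\<xi>. complex_of_real (c1 * (1 + (norm \<xi>)\<^sup>2) powr (- r)) \<le> fourier_transform \<Phi> \<xi>"
    and "\<And>\<xi>. fourier_transform \<Phi> \<xi> \<le> complex_of_real (c2 * (1 + (norm \<xi>)\<^sup>2) powr (- r))"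
    and "\<And>n. n \<ge> 2 \<Longrightarrow> inj_on (x n) {..<n}"
    and "\<And>n. n \<ge> 2 \<Longrightarrow> x n ` {..<n} \<subseteq> \<Omega>"
  shows "(\<exists>C h0. C > 0 \<and> h0 > 0 \<and>
      (\<forall>n\<ge>2. fill_distance (x n ` {..<n}) \<Omega> \<le> h0 \<longrightarrow>
        bq_lebesgue_constant k \<nu> n (x n) \<le>
          C * real n
            * (fill_distance (x n ` {..<n}) \<Omega> / separation_distance (x n ` {..<n}))
                powr (r - real DIM('a) / 2)
            * fill_distance (x n ` {..<n}) \<Omega> powr (real DIM('a) / 2)))
    \<and> (quasi_uniform x \<Omega> \<longrightarrow>
      (\<exists>C'>0. \<exists>n0. \<forall>n\<ge>n0. bq_lebesgue_constant k \<nu> n (x n) \<le> C' * sqrt (real n)))"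
proof -
  interpret sobolev_kernel \<Phi> r c1 c2
    by unfold_locales (fact assms(7-14))+
  note k = assms(6)
  have \<nu>: "prob_space \<nu>" "sets \<nu> = sets (restrict_space borel \<Omega>)"
    using assms(5) unfolding probability_with_bounded_density_def by blast+
  define \<alpha> where "\<alpha> = r - real DIM('a) / 2"
  have \<alpha>: "\<alpha> > 0" using r by (simp add: \<alpha>_def)
  define h where "h n = fill_distance (x n ` {..<n}) \<Omega>" for n
  define q where "q n = separation_distance (x n ` {..<n})" for n
  obtain C h0 where C: "0 < C" and h0: "0 < h0"
    and main: "\<forall>n y. 2 \<le> n \<longrightarrow> inj_on y {..<n} \<longrightarrow> y ` {..<n} \<subseteq> \<Omega> \<longrightarrow>
     fill_distance (y ` {..<n}) \<Omega> \<le> h0 \<longrightarrow>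
     separation_distance (y ` {..<n}) \<le> fill_distance (y ` {..<n}) \<Omega> \<and>
     bq_lebesgue_constant (\<lambda>u v. \<Phi> (u - v)) \<nu> n y
       \<le> C * sqrt (real n) * (fill_distance (y ` {..<n}) \<Omega> / separation_distance (y ` {..<n})) powr (r - DIM('a) / 2)"
    using bq_lebesgue_constant_le[OF assms(3) assms(1) \<nu>] by (elim exE conjE)
  have bound: "q n \<le> h n \<and> bq_lebesgue_constant k \<nu> n (x n) \<le> C * sqrt (real n) * (h n / q n) powr \<alpha>"
    if "2 \<le> n" "h n \<le> h0" for n
    using main[THEN spec[of _ n], THEN spec[of _ "x n"]] that assms(15,16)[OF that(1)]
    unfolding h_def q_def k \<alpha>_def by simp
  have card: "card (x n ` {..<n}) = n" if "2 \<le> n" for n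
    using card_image[OF assms(15)[OF that]] by simp
  have q_pos: "0 < q n" if "2 \<le> n" for n
    unfolding q_def
  proof (rule separation_distance_pos)
    show "x n 0 \<noteq> x n 1" using inj_on_eq_iff[OF assms(15)[OF that], of 0 1] that by simp
  qed (use that in auto)
  have ne: "\<Omega> \<noteq> {}"
  proof -
    have "x 2 0 \<in> \<Omega>" by (rule subsetD[OF assms(16)[of 2]]) auto
    thus ?thesis by blast
  qed
  obtain v where v: "v > 0" and vol: "\<forall>X. finite X \<longrightarrow> X \<noteq> {} \<longrightarrow> 0 \<le> fill_distance X \<Omega> \<longrightarrow>
    v \<le> real (card X) * fill_distance X \<Omega> ^ DIM('a)"
    using fill_distance_volume[OF assms(2) assms(1) ne] by (elim exE conjE)
  have first: "bq_lebesgue_constant k \<nu> n (x n) \<le> (C / sqrt v) * real n * (h n / q n) powr \<alpha> * h n powr (real DIM('a) / 2)"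
    if n: "2 \<le> n" and hn: "h n \<le> h0" for n
  proof -
    have qh: "0 < q n" "q n \<le> h n" using q_pos[OF n] bound[OF n hn] by auto
    hence hp: "0 < h n" by linarith
    have "v \<le> real n * h n ^ DIM('a)"
      using vol[THEN spec[of _ "x n ` {..<n}"]] hp card[OF n] n unfolding h_def[symmetric] by auto
    hence "sqrt v \<le> sqrt (real n * h n ^ DIM('a))" by simp
    also have "\<dots> = sqrt (real n) * h n powr (real DIM('a) / 2)"
    proof -
      have "h n powr (real DIM('a) / 2) = (h n powr real DIM('a)) powr (1 / 2)" by (simp add: powr_powr)
      thus ?thesis using hp by (simp add: real_sqrt_mult powr_half_sqrt powr_realpow)
    qed
    finally have sv: "1 \<le> sqrt (real n) * h n powr (real DIM('a) / 2) / sqrt v" using v by simp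
    have "C * sqrt (real n) * (h n / q n) powr \<alpha> * 1
        \<le> C * sqrt (real n) * (h n / q n) powr \<alpha> * (sqrt (real n) * h n powr (real DIM('a) / 2) / sqrt v)"
      using C sv by (intro mult_left_mono) auto
    also have "\<dots> = (C / sqrt v) * (sqrt (real n) * sqrt (real n)) * (h n / q n) powr \<alpha> * h n powr (real DIM('a) / 2)"
      by simp
    finally show ?thesis using bound[OF n hn] by simp
  qed
  show ?thesis
  proof (intro conjI impI)
    show "\<exists>C h0. C > 0 \<and> h0 > 0 \<and>
      (\<forall>n\<ge>2. fill_distance (x n ` {..<n}) \<Omega> \<le> h0 \<longrightarrow>
        bq_lebesgue_constant k \<nu> n (x n) \<le>
          C * real n
            * (fill_distance (x n ` {..<n}) \<Omega> / separation_distance (x n ` {..<n}))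
                powr (r - real DIM('a) / 2)
            * fill_distance (x n ` {..<n}) \<Omega> powr (real DIM('a) / 2))"
    proof (rule exI[of _ "C / sqrt v"], rule exI[of _ h0], intro conjI allI impI)
      show "0 < C / sqrt v" using C v by simp
    qed (use h0 first in \<open>simp_all add: h_def q_def \<alpha>_def\<close>)
  next
    assume "quasi_uniform x \<Omega>"
    then obtain a b where ab: "0 < b" "\<And>n. 2 \<le> n \<Longrightarrow> h n \<le> b * q n"
      unfolding quasi_uniform_def h_def q_def by blast
    obtain m where m: "\<forall>X. finite X \<longrightarrow> X \<subseteq> \<Omega> \<longrightarrow> m < card X \<longrightarrow> separation_distance X < h0 / b"
      using separation_distance_eventually_small[OF assms(1), of "h0 / b"] h0 ab by auto
    show "\<exists>C'>0. \<exists>n0. \<forall>n\<ge>n0. bq_lebesgue_constant k \<nu> n (x n) \<le> C' * sqrt (real n)"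
    proof (rule exI[of _ "C * b powr \<alpha>"], intro conjI exI[of _ "m + 2"] allI impI)
      show "0 < C * b powr \<alpha>" using C ab by simp
      fix n assume nm: "m + 2 \<le> n"
      hence n: "2 \<le> n" by simp
      have "q n < h0 / b"
        unfolding q_def using m[THEN spec[of _ "x n ` {..<n}"]] card[OF n] assms(16)[OF n] nm by simp
      hence "b * q n < h0" using ab by (simp add: less_divide_eq mult.commute)
      hence hn: "h n \<le> h0" using ab(2)[OF n] by linarith
      have qh: "0 < q n" "q n \<le> h n" using q_pos[OF n] bound[OF n hn] by auto
      have "(h n / q n) powr \<alpha> \<le> b powr \<alpha>"
        using ab(2)[OF n] qh \<alpha> by (intro powr_mono2) (auto simp: divide_le_eq)
      hence "C * sqrt (real n) * (h n / q n) powr \<alpha> \<le> C * sqrt (real n) * b powr \<alpha>"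
        using C by (intro mult_left_mono) auto
      thus "bq_lebesgue_constant k \<nu> n (x n) \<le> C * b powr \<alpha> * sqrt (real n)"
        using bound[OF n hn] by (simp add: mult_ac)
    qed
  qed
qed

end
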